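(* Fix $0<q<1$. Then $$\lim_{n\to\infty}\sup_{G\in\mathcal G}\big|\mathcal R_n(\hat T_{q,n},G)-\tilde{\mathcal R}(T_q,G)\big|=0,$$ and consequently, for every $0<p<2$ and $\eta>0$, $\lim_{n\to\infty}\sup_{G\in\mathcal G_p(\eta)}|\mathcal R_n(\hat T_{q,n},G)-\tilde{\mathcal R}(T_q,G)|=0$.
   Context: $E(t)=1-e^{-t}$, $\bar E=1-E$, $\bar G=1-G$ for a cdf $G$. $\mathcal F$: probability distributions on $[1,\infty)$; $\mathcal G=\{E\#F:F\in\mathcal F\}$ where $(E\#F)(t)=\int E(t/\mu)\,dF(\mu)$; $\mathcal G_p(\eta)=\{E\#F:\int\log^p\mu\,dF\le\eta^p\}$. FDR functional $T_q(G)=\inf\{t:\bar G(t)\ge\frac1q\bar E(t)\}$ ($\inf\emptyset=+\infty$), applied to any cdf. Bayesian model: $(\mu_i,X_i)$, $i=1,\dots,n$, i.i.d. with $\mu_i\sim F$ and $X_i\mid\mu_i\sim\mathrm{Exp}(\mu_i)$ (mean $\mu_i$), so $X_i\sim G=E\#F$. Empirical cdf $G_n(t)=\frac1n\sum_i\mathbb 1\{X_i<t\}$. Threshold $\hat T_{q,n}=T_q(G_n)$ if $T_q(G_n)<\infty$, and $\hat T_{q,n}=\log(n/q)$ otherwise. Estimator: $\hat\mu_i=X_i$ if $X_i\ge\hat T_{q,n}$, else $1$; risk $\mathcal R_n(\hat T_{q,n},G)=\mathbb{E}[\frac1n\sum_i(\log\hat\mu_i-\log\mu_i)^2]$. Ideal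 risk: $\tilde{\mathcal R}(T_q,G)=\mathbb{E}(\log\delta_{T_q(G)}(X_1)-\log\mu_1)^2$ with $\delta_t(x)=x$ if $x\ge t$ and $1$ otherwise ($\delta_{+\infty}\equiv1$). *)

theory Defs
  imports "HOL-Probability.Probability"
begin

definition Ecdf :: "real \<Rightarrow> real" where
  "Ecdf t = (if t < 0 then 0 else 1 - exp (- t))"

definition Ebar :: "real \<Rightarrow> real" where
  "Ebar t = 1 - Ecdf t"

definition FF :: "real measure set" where
  "FF = {F. prob_space F \<and> sets F = sets borel \<and> emeasure F {..<1} = 0}"

definition Gmix :: "real measure \<Rightarrow> real \<Rightarrow> real" where
  "Gmix F t = (\<integral>\<mu>. Ecdf (t / \<mu>) \<partial>F)"

(* FDR functional T_q applied to a cdf G; value +\<infinity> if the set is empty *)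
definition Tq :: "real \<Rightarrow> (real \<Rightarrow> real) \<Rightarrow> ereal" where
  "Tq q G = Inf {ereal t | t. 1 - G t \<ge> Ebar t / q}"

definition Gemp :: "nat \<Rightarrow> (nat \<Rightarrow> real) \<Rightarrow> real \<Rightarrow> real" where
  "Gemp n X t = real (card {i \<in> {..<n}. X i < t}) / real n"

definition That :: "real \<Rightarrow> nat \<Rightarrow> (nat \<Rightarrow> real) \<Rightarrow> real" where
  "That q n X = (if Tq q (Gemp n X) < \<infinity> then real_of_ereal (Tq q (Gemp n X))
                 else ln (real n / q))"

definition delta :: "ereal \<Rightarrow> real \<Rightarrow> real" where
  "delta t x = (if ereal x \<ge> t then x else 1)"

(* joint law of (\<mu>, X): \<mu> ~ F, X | \<mu> ~ Exp with mean \<mu> *)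
definition pairlaw :: "real measure \<Rightarrow> (real \<times> real) measure" where
  "pairlaw F = density (F \<Otimes>\<^sub>M lborel)
      (\<lambda>(\<mu>, x). ennreal (exponential_density (1 / \<mu>) x))"

definition Rn :: "real \<Rightarrow> nat \<Rightarrow> real measure \<Rightarrow> real" where
  "Rn q n F = (\<integral>\<omega>. (1 / real n) *
      (\<Sum>i<n. (ln (delta (ereal (That q n (\<lambda>j. snd (\<omega> j)))) (snd (\<omega> i)))
                 - ln (fst (\<omega> i)))\<^sup>2)
      \<partial>(PiM {..<n} (\<lambda>_. pairlaw F)))"

definition Rtilde :: "real \<Rightarrow> real measure \<Rightarrow> real" where
  "Rtilde q F = (\<integral>(\<mu>, x). (ln (delta (Tq q (Gmix F)) x) - ln \<mu>)\<^sup>2 \<partial>pairlaw F)"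

definition FFp :: "real \<Rightarrow> real \<Rightarrow> real measure set" where
  "FFp p \<eta> = {F \<in> FF. (\<integral>\<^sup>+\<mu>. ennreal ((ln \<mu>) powr p) \<partial>F) \<le> ennreal (\<eta> powr p)}"

end

(* Put tilt F t = \<integral> exp (t (1 - 1/\<mu>)) dF, so that 1 - G t = exp (-t) tilt F t and T = T_q(G) solves
   tilt F T = 1/q. Since tilt is convex with tilt F 0 = 1, it crosses the level 1/q with slope at least
   (1/q - 1)/T. Hoeffding's inequality then gives, uniformly in F, that the empirical threshold is close
   to T when T is bounded, and large when T is large. The two losses differ at X only if X lies between
   the two thresholds, which has small probability in both cases.
   What remains is a uniform bound on the second moment of the losses. The danger is a large ln \<mu> paired
   with X below the threshold; but P(X < 16 T | \<mu>) \<le> 16 T/\<mu>, and (ln \<mu>)^4 min(1, 16 T/\<mu>) is at most a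
   constant times exp (T (1 - 1/\<mu>)), whose F-mean is 1/q. The empirical threshold is at most ln (n/q),
   hence below 16 T if T > (ln n)/8; otherwise it exceeds 2 T only with probability
   exp (- c sqrt n), which beats the logarithmic growth in n of the second moment on that event. *)

theory Submission
  imports Defs "HOL-Probability.Hoeffding" "HOL-Real_Asymp.Real_Asymp"
begin

section \<open>Exponential mixtures\<close>

lemma exponential_density_tail:
  assumes l: "0 < l" and t: "0 \<le> t"
  shows "(\<integral>\<^sup>+x. ennreal (exponential_density l x) * indicator {t..} x \<partial>lborel) = ennreal (exp (- t * l))"
proof -
  interpret D: prob_space "density lborel (exponential_density l)"
    by (rule prob_space_exponential_density[OF l])
  have "distributed (density lborel (exponential_density l)) lborel (\<lambda>x. x) (exponential_density l)"
    by (simp add: distributed_def) (rule distr_id2, simp)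
  from D.exponential_distributedD_gt[OF this t l]
  have *: "D.prob {t<..} = exp (- t * l)"
    by (simp add: greaterThan_def)
  have "(\<integral>\<^sup>+x. ennreal (exponential_density l x) * indicator {t..} x \<partial>lborel) =
        (\<integral>\<^sup>+x. ennreal (exponential_density l x) * indicator {t<..} x \<partial>lborel)"
    by (rule nn_integral_cong_AE) (use AE_lborel_singleton[of t] in \<open>auto simp: indicator_def\<close>)
  also have "\<dots> = emeasure (density lborel (exponential_density l)) {t<..}"
    by (simp add: emeasure_density)
  finally show ?thesis
    using * by (simp add: D.emeasure_eq_measure)
qed

lemma exponential_density_le:
  assumes "0 < l"
  shows "exponential_density l x \<le> l"
  using assms by (auto simp: exponential_density_def)

lemma nn_integral_Gamma_kernel:
  assumes "0 < (x::real)"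
  shows "(\<integral>\<^sup>+t. ennreal (t powr (x - 1) / exp t) * indicator {0..} t \<partial>lborel) = ennreal (Gamma x)"
  using Gamma_integral_real[OF assms] by (intro nn_integral_has_integral_lebesgue') auto

lemma ln_le_powr_mult:
  fixes x :: real assumes "0 < x" "0 < a" shows "a * ln x \<le> x powr a"
  using ln_powr[of x a] ln_le_minus_one[of "x powr a"] assms by simp

text \<open>The left side is invariant under replacing \<open>y\<close> by \<open>1/y\<close>, so
  one estimate on \<open>y \<ge> 1\<close>, with 4096 = 8^4, covers both ranges. The exponents are
  left as \<open>3/2 - 1\<close> and \<open>1/2 - 1\<close> to match the kernel of the Gamma
  integral.\<close>

lemma ln_pow4_le:
  fixes y :: real assumes y: "0 < y"
  shows "(ln y) ^ 4 \<le> 4096 * (y powr (3/2 - 1) + y powr (1/2 - 1))"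
proof -
  have *: "(ln z) ^ 4 \<le> 4096 * z powr (1/2)" if "1 \<le> z" for z :: real
  proof -
    have "ln z \<le> 8 * z powr (1/8)"
      using ln_le_powr_mult[of z "1/8"] that by simp
    then have "(ln z) ^ 4 \<le> (8 * z powr (1/8)) ^ 4"
      using that by (intro power_mono) auto
    also have "\<dots> = 4096 * z powr (1/2)"
      using that by (simp add: power_mult_distrib powr_power)
    finally show ?thesis .
  qed
  show ?thesis
  proof (cases "1 \<le> y")
    case True
    then show ?thesis using *[of y] by (simp add: add_increasing2)
  next
    case False
    have "(ln y) ^ 4 = (ln (1 / y)) ^ 4" using y by (simp add: ln_div)
    also have "\<dots> \<le> 4096 * (1 / y) powr (1/2)" using False y by (intro *) simp
    also have "(1 / y) powr (1/2) = y powr (1/2 - 1)"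
      using y by (simp add: powr_divide powr_minus_divide)
    finally show ?thesis by (simp add: add_increasing)
  qed
qed

definition log_moment :: real where
  "log_moment = 4096 * (Gamma (3/2) + Gamma (1/2))"

lemma log_moment_nonneg: "0 \<le> log_moment"
  unfolding log_moment_def by (intro mult_nonneg_nonneg add_nonneg_nonneg Gamma_real_nonneg) auto

text \<open>If X is exponential with mean \<open>m\<close>, then X/m is standard exponential, and
  the law of ln X - ln m does not depend on \<open>m\<close>. The substitution by the factor
  \<open>m\<close> carries this out, and the bound is therefore uniform in \<open>m\<close>.\<close>

lemma exponential_density_log_moment:
  assumes m: "0 < m"
  shows "(\<integral>\<^sup>+x. ennreal (exponential_density (1 / m) x) * ennreal ((ln x - ln m) ^ 4) \<partial>lborel)
         \<le> ennreal log_moment"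
proof -
  have "(\<integral>\<^sup>+x. ennreal (exponential_density (1 / m) x) * ennreal ((ln x - ln m) ^ 4) \<partial>lborel) =
     ennreal m * (\<integral>\<^sup>+x. ennreal (exponential_density (1 / m) (0 + m * x)) * ennreal ((ln (0 + m * x) - ln m) ^ 4) \<partial>lborel)"
    using m by (subst nn_integral_real_affine[where c=m and t=0]) auto
  also have "\<dots> = (\<integral>\<^sup>+x. ennreal m * (ennreal (exponential_density (1 / m) (m * x)) * ennreal ((ln (m * x) - ln m) ^ 4)) \<partial>lborel)"
    by (simp add: nn_integral_cmult)
  also have "\<dots> \<le> (\<integral>\<^sup>+x. 4096 * (ennreal (x powr (3/2 - 1) / exp x) * indicator {0..} x +
                        ennreal (x powr (1/2 - 1) / exp x) * indicator {0..} x) \<partial>lborel)"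
  proof (rule nn_integral_mono_AE)
    show "AE x in lborel. ennreal m * (ennreal (exponential_density (1 / m) (m * x)) * ennreal ((ln (m * x) - ln m) ^ 4))
       \<le> 4096 * (ennreal (x powr (3/2 - 1) / exp x) * indicator {0..} x +
                        ennreal (x powr (1/2 - 1) / exp x) * indicator {0..} x)"
      \<comment> \<open>At \<open>x = 0\<close> the density is positive, but the right side vanishes
        because \<open>0 powr a = 0\<close>. The point is discarded as a null set.\<close>
      using AE_lborel_singleton[of 0]
    proof eventually_elim
      case (elim x)
      show ?case
      proof (cases "x < 0")
        case True
        then show ?thesis using m by (simp add: exponential_density_def mult_less_0_iff)
      next
        case False
        then have x: "0 < x" using elim by simp
        have "m * (exponential_density (1 / m) (m * x) * (ln (m * x) - ln m) ^ 4) = exp (- x) * (ln x) ^ 4"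
          using x m by (simp add: exponential_density_def ln_mult not_less) (simp add: mult_less_0_iff)
        also have "\<dots> \<le> exp (- x) * (4096 * (x powr (3/2 - 1) + x powr (1/2 - 1)))"
          by (intro mult_left_mono ln_pow4_le x) auto
        also have "\<dots> = 4096 * (x powr (3/2 - 1) / exp x + x powr (1/2 - 1) / exp x)"
          by (simp add: exp_minus field_simps)
        finally have "ennreal (m * (exponential_density (1 / m) (m * x) * (ln (m * x) - ln m) ^ 4)) \<le>
          ennreal (4096 * (x powr (3/2 - 1) / exp x + x powr (1/2 - 1) / exp x))"
          by (rule ennreal_leI)
        moreover have "ennreal (4096 * (a + b)) = 4096 * (ennreal a + ennreal b)"
          if "0 \<le> a" "0 \<le> b" for a b
          using that by (simp add: ennreal_mult del: distrib_left_numeral)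
        ultimately show ?thesis
          using x m by (simp add: ennreal_mult del: distrib_left_numeral)
      qed
    qed
  qed
  also have "\<dots> = 4096 * (ennreal (Gamma (3/2)) + ennreal (Gamma (1/2)))"
    using nn_integral_Gamma_kernel[of "3/2"] nn_integral_Gamma_kernel[of "1/2"]
    by (simp add: nn_integral_cmult nn_integral_add del: distrib_left_numeral)
  also have "\<dots> = ennreal log_moment"
    by (simp add: log_moment_def ennreal_mult Gamma_real_nonneg)
  finally show ?thesis .
qed

text \<open>The density is at most \<open>l\<close> and lives on the nonnegative axis. With
  \<open>l = 1/m\<close> this says that a large mean seldom produces an observation below
  \<open>b\<close>.\<close>

lemma exponential_density_below:
  assumes l: "0 < l" and "0 \<le> b"
  shows "(\<integral>\<^sup>+x. ennreal (exponential_density l x) * indicator {x. x < b} x \<partial>lborel) \<le> ennreal (b * l)"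
proof -
  have "(\<integral>\<^sup>+x. ennreal (exponential_density l x) * indicator {x. x < b} x \<partial>lborel)
     \<le> (\<integral>\<^sup>+x. ennreal l * indicator {0..b} x \<partial>lborel)"
    using l by (intro nn_integral_mono)
      (auto simp: indicator_def exponential_density_def intro!: ennreal_leI mult_left_le)
  also have "\<dots> = ennreal (b * l)"
    using assms by (simp add: nn_integral_cmult ennreal_mult mult.commute)
  finally show ?thesis .
qed

section \<open>The joint law of mean and observation\<close>

locale mixing = prob_space F for F :: "real measure" +
  assumes sets_F [measurable_cong]: "sets F = sets borel"
    and AE_ge_1: "AE \<mu> in F. 1 \<le> \<mu>"
begin

lemma space_F [simp]: "space F = UNIV"
  using sets_eq_imp_space_eq[OF sets_F] by simp

lemma emeasure_F_UNIV [simp]: "emeasure F UNIV = 1" and measure_F_UNIV [simp]: "prob UNIV = 1"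
  using emeasure_space_1 prob_space by simp_all

lemma measurable_exponential_kernel [measurable]:
  "(\<lambda>z. exponential_density (1 / fst z) (snd z)) \<in> borel_measurable (F \<Otimes>\<^sub>M lborel)"
  unfolding exponential_density_def by measurable

lemma sets_pairlaw [measurable_cong]: "sets (pairlaw F) = sets (borel \<Otimes>\<^sub>M borel)"
  unfolding pairlaw_def by (simp add: sets_F cong: sets_pair_measure_cong)

lemma space_pairlaw [simp]: "space (pairlaw F) = UNIV"
  using sets_eq_imp_space_eq[OF sets_pairlaw] by (simp add: space_pair_measure)

lemma nn_integral_pairlaw:
  assumes [measurable]: "f \<in> borel_measurable (borel \<Otimes>\<^sub>M borel)"
  shows "(\<integral>\<^sup>+z. f z \<partial>pairlaw F) =
    (\<integral>\<^sup>+\<mu>. \<integral>\<^sup>+x. ennreal (exponential_density (1 / \<mu>) x) * f (\<mu>, x) \<partial>lborel \<partial>F)"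
proof -
  have "(\<integral>\<^sup>+z. f z \<partial>pairlaw F) =
      (\<integral>\<^sup>+z. ennreal (exponential_density (1 / fst z) (snd z)) * f z \<partial>(F \<Otimes>\<^sub>M lborel))"
    unfolding pairlaw_def split_def by (subst nn_integral_density) auto
  also have "\<dots> = (\<integral>\<^sup>+\<mu>. \<integral>\<^sup>+x. ennreal (exponential_density (1 / \<mu>) x) * f (\<mu>, x) \<partial>lborel \<partial>F)"
    by (subst lborel.nn_integral_fst[symmetric]) auto
  finally show ?thesis .
qed

lemma nn_integral_pairlaw_le:
  assumes [measurable]: "f \<in> borel_measurable (borel \<Otimes>\<^sub>M borel)"
    and "\<And>\<mu>. 1 \<le> \<mu> \<Longrightarrow> (\<integral>\<^sup>+x. ennreal (exponential_density (1 / \<mu>) x) * f (\<mu>, x) \<partial>lborel) \<le> g \<mu>"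
  shows "(\<integral>\<^sup>+z. f z \<partial>pairlaw F) \<le> (\<integral>\<^sup>+\<mu>. g \<mu> \<partial>F)"
  unfolding nn_integral_pairlaw[OF assms(1)]
  by (rule nn_integral_mono_AE) (use AE_ge_1 in eventually_elim, rule assms)

lemma prob_space_pairlaw: "prob_space (pairlaw F)"
proof
  have *: "(\<integral>\<^sup>+x. ennreal (exponential_density (1 / \<mu>) x) \<partial>lborel) = 1" if "1 \<le> \<mu>" for \<mu>
    using prob_space.emeasure_space_1[OF prob_space_exponential_density[of "1 / \<mu>"]] that
    by (simp add: emeasure_density)
  have "emeasure (pairlaw F) (space (pairlaw F)) = (\<integral>\<^sup>+z. 1 \<partial>pairlaw F)"
    by simp
  also have "\<dots> = (\<integral>\<^sup>+\<mu>. 1 \<partial>F)"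
    unfolding nn_integral_pairlaw[OF borel_measurable_const]
    by (rule nn_integral_cong_AE) (use AE_ge_1 in eventually_elim, simp add: *)
  finally show "emeasure (pairlaw F) (space (pairlaw F)) = 1"
    by (simp add: emeasure_space_1)
qed

end

section \<open>The exponential tilt of the mixing distribution\<close>

definition tilt :: "real measure \<Rightarrow> real \<Rightarrow> real" where
  "tilt F t = (\<integral>\<mu>. exp (t * (1 - 1 / \<mu>)) \<partial>F)"

context mixing
begin

lemma integrable_tilt [simp]: "integrable F (\<lambda>\<mu>. exp (t * (1 - 1 / \<mu>)))"
proof (rule integrable_const_bound[where B = "exp \<bar>t\<bar>"])
  show "AE \<mu> in F. norm (exp (t * (1 - 1 / \<mu>))) \<le> exp \<bar>t\<bar>"
    using AE_ge_1
  proof eventually_elim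
    case (elim \<mu>)
    then have "\<bar>1 - 1 / \<mu>\<bar> \<le> 1" by (simp add: abs_le_iff)
    then have "\<bar>t * (1 - 1 / \<mu>)\<bar> \<le> \<bar>t\<bar>"
      by (simp add: abs_mult mult_left_le)
    then show ?case by simp
  qed
qed measurable

lemma tilt_0: "tilt F 0 = 1"
  by (simp add: tilt_def prob_space)

lemma tilt_mono: "s \<le> t \<Longrightarrow> tilt F s \<le> tilt F t"
  unfolding tilt_def
  by (rule integral_mono_AE) (use AE_ge_1 in \<open>auto elim!: eventually_mono intro!: mult_right_mono\<close>)

lemma convex_tilt: "convex_on UNIV (tilt F)"
proof (rule convex_onI)
  fix u x y :: real assume u: "0 < u" "u < 1"
  have "tilt F ((1 - u) *\<^sub>R x + u *\<^sub>R y)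
      \<le> (\<integral>\<mu>. (1 - u) * exp (x * (1 - 1 / \<mu>)) + u * exp (y * (1 - 1 / \<mu>)) \<partial>F)"
    unfolding tilt_def
  proof (rule integral_mono)
    fix \<mu>
    have "exp ((1 - u) *\<^sub>R (x * (1 - 1 / \<mu>)) + u *\<^sub>R (y * (1 - 1 / \<mu>)))
        \<le> (1 - u) * exp (x * (1 - 1 / \<mu>)) + u * exp (y * (1 - 1 / \<mu>))"
      using u by (intro convex_onD[OF exp_convex]) auto
    then show "exp (((1 - u) *\<^sub>R x + u *\<^sub>R y) * (1 - 1 / \<mu>))
        \<le> (1 - u) * exp (x * (1 - 1 / \<mu>)) + u * exp (y * (1 - 1 / \<mu>))"
      by (simp only: real_scaleR_def distrib_right mult.assoc)
  qed auto
  also have "\<dots> = (1 - u) * tilt F x + u * tilt F y"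
    by (simp add: tilt_def)
  finally show "tilt F ((1 - u) *\<^sub>R x + u *\<^sub>R y) \<le> (1 - u) * tilt F x + u * tilt F y" .
qed auto

lemma isCont_tilt: "isCont (tilt F) t"
  using convex_on_continuous[OF open_UNIV convex_tilt] by (simp add: continuous_on_eq_continuous_at)

text \<open>By convexity the chord slope \<open>(tilt F t - 1) / t\<close> from the point (0, 1) is
  nondecreasing in \<open>t\<close>; the inequality is multiplied out to avoid division. It keeps
  \<open>tilt F\<close> from being flat where it crosses \<open>1/q\<close>.\<close>

lemma tilt_slope_mono:
  assumes "0 < s" "s \<le> t"
  shows "(tilt F s - 1) * t \<le> (tilt F t - 1) * s"
proof -
  have "tilt F ((1 - s / t) *\<^sub>R 0 + (s / t) *\<^sub>R t) \<le> (1 - s / t) * tilt F 0 + (s / t) * tilt F t"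
    using assms by (intro convex_onD[OF convex_tilt]) auto
  then have "tilt F s \<le> (1 - s / t) + (s / t) * tilt F t"
    using assms by (simp add: tilt_0)
  then have "tilt F s * t \<le> ((1 - s / t) + (s / t) * tilt F t) * t"
    using assms by (intro mult_right_mono) auto
  also have "\<dots> = t - s + s * tilt F t"
    using assms by (simp add: field_simps)
  finally show ?thesis by (simp add: algebra_simps)
qed

lemma exp_tilt: "exp (- t) * tilt F t = (\<integral>\<mu>. exp (- t / \<mu>) \<partial>F)"
  unfolding tilt_def integral_mult_right_zero[symmetric]
  by (rule Bochner_Integration.integral_cong) (auto simp: exp_add[symmetric] algebra_simps)

lemma integrable_exp_tilt: "integrable F (\<lambda>\<mu>. exp (- t / \<mu>))"
proof -
  have "integrable F (\<lambda>\<mu>. exp (- t) * exp (t * (1 - 1 / \<mu>)))" by simp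
  then show ?thesis by (simp add: exp_add[symmetric] algebra_simps)
qed

lemma one_minus_Gmix:
  assumes t: "0 \<le> t"
  shows "1 - Gmix F t = exp (- t) * tilt F t"
proof -
  have "Gmix F t = (\<integral>\<mu>. 1 - exp (- t / \<mu>) \<partial>F)"
    unfolding Gmix_def
  proof (rule integral_cong_AE)
    show "AE \<mu> in F. Ecdf (t / \<mu>) = 1 - exp (- t / \<mu>)"
      using AE_ge_1 by eventually_elim (use t in \<open>auto simp: Ecdf_def divide_less_0_iff\<close>)
  qed (auto simp: Ecdf_def)
  also have "\<dots> = 1 - exp (- t) * tilt F t"
    by (subst Bochner_Integration.integral_diff[OF _ integrable_exp_tilt]) (simp_all add: exp_tilt)
  finally show ?thesis by simp
qed

lemma Gmix_neg:
  assumes t: "t < 0"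
  shows "Gmix F t = 0"
proof -
  have "Gmix F t = (\<integral>\<mu>. 0 \<partial>F)"
    unfolding Gmix_def
  proof (rule integral_cong_AE)
    show "AE \<mu> in F. Ecdf (t / \<mu>) = 0"
      using AE_ge_1 by eventually_elim (use t in \<open>auto simp: Ecdf_def divide_less_0_iff\<close>)
  qed (auto simp: Ecdf_def)
  then show ?thesis by simp
qed

lemma pairlaw_tail:
  assumes t: "0 \<le> t"
  shows "measure (pairlaw F) {z. t \<le> snd z} = exp (- t) * tilt F t"
proof -
  interpret P: prob_space "pairlaw F" by (rule prob_space_pairlaw)
  have "{z \<in> space (pairlaw F). t \<le> snd z} \<in> sets (pairlaw F)" by measurable
  then have [measurable]: "{z. t \<le> snd z} \<in> sets (pairlaw F)" by simp
  have "emeasure (pairlaw F) {z. t \<le> snd z} = (\<integral>\<^sup>+z. indicator {z. t \<le> snd z} z \<partial>pairlaw F)"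
    by simp
  also have "\<dots> = (\<integral>\<^sup>+z. indicator {t..} (snd z) \<partial>pairlaw F)"
    by (intro nn_integral_cong) (simp add: indicator_def)
  also have "\<dots> = (\<integral>\<^sup>+\<mu>. \<integral>\<^sup>+x. ennreal (exponential_density (1 / \<mu>) x) * indicator {t..} x \<partial>lborel \<partial>F)"
    by (subst nn_integral_pairlaw) auto
  also have "\<dots> = (\<integral>\<^sup>+\<mu>. ennreal (exp (- t / \<mu>)) \<partial>F)"
    by (rule nn_integral_cong_AE) (use AE_ge_1 in eventually_elim, simp add: exponential_density_tail t)
  also have "\<dots> = ennreal (exp (- t) * tilt F t)"
    unfolding exp_tilt by (rule nn_integral_eq_integral[OF integrable_exp_tilt]) auto
  finally show ?thesis
    by (simp add: P.emeasure_eq_measure tilt_def)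
qed

text \<open>Means of at least 1 give conditional densities of at most 1, so the observation has a
  density bounded by 1 whatever \<open>F\<close> is.\<close>

lemma pairlaw_window:
  assumes "0 \<le> e"
  shows "measure (pairlaw F) {z. \<bar>snd z - t\<bar> \<le> e} \<le> 2 * e"
proof -
  interpret P: prob_space "pairlaw F" by (rule prob_space_pairlaw)
  have "{z \<in> space (pairlaw F). \<bar>snd z - t\<bar> \<le> e} \<in> sets (pairlaw F)" by measurable
  then have [measurable]: "{z. \<bar>snd z - t\<bar> \<le> e} \<in> sets (pairlaw F)" by simp
  have *: "(\<integral>\<^sup>+x. ennreal (exponential_density (1 / \<mu>) x) * indicator {t - e..t + e} x \<partial>lborel) \<le> ennreal (2 * e)"
    if "1 \<le> \<mu>" for \<mu>
  proof -
    have "(\<integral>\<^sup>+x. ennreal (exponential_density (1 / \<mu>) x) * indicator {t - e..t + e} x \<partial>lborel)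
        \<le> (\<integral>\<^sup>+x. indicator {t - e..t + e} x \<partial>lborel)"
      using order_trans[OF exponential_density_le[of "1 / \<mu>"], of 1] that
      by (intro nn_integral_mono) (auto simp: indicator_def)
    then show ?thesis using assms by simp
  qed
  have "emeasure (pairlaw F) {z. \<bar>snd z - t\<bar> \<le> e} = (\<integral>\<^sup>+z. indicator {z. \<bar>snd z - t\<bar> \<le> e} z \<partial>pairlaw F)"
    by simp
  also have "\<dots> = (\<integral>\<^sup>+z. indicator {t - e..t + e} (snd z) \<partial>pairlaw F)"
    by (intro nn_integral_cong) (auto simp: indicator_def abs_le_iff)
  also have "\<dots> \<le> (\<integral>\<^sup>+\<mu>. ennreal (2 * e) \<partial>F)"
    by (rule nn_integral_pairlaw_le) (auto simp: *)
  finally show ?thesis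
    using assms by (simp add: P.emeasure_eq_measure emeasure_space_1)
qed

end

section \<open>The population threshold\<close>

locale fdr_mixing = mixing +
  fixes q :: real
  assumes q: "0 < q" "q < 1"
begin

text \<open>For \<open>t \<ge> 0\<close> the common factor \<open>exp (- t)\<close> cancels. For
  \<open>t < 0\<close> both conditions fail, because \<open>1 / q > 1\<close>, so the two sets agree
  on the whole line.\<close>

lemma crossing_set: "{t. 1 - Gmix F t \<ge> Ebar t / q} = {t. 1 / q \<le> tilt F t}"
proof -
  have "1 - Gmix F t \<ge> Ebar t / q \<longleftrightarrow> 1 / q \<le> tilt F t" for t
  proof (cases "t < 0")
    case True
    then have "tilt F t \<le> 1" using tilt_mono[of t 0] tilt_0 by simp
    also have "1 < 1 / q" using q by simp
    finally show ?thesis using True q by (simp add: Gmix_neg Ebar_def Ecdf_def)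
  next
    case False
    then have "1 - Gmix F t = exp (- t) * tilt F t" "Ebar t / q = exp (- t) * (1 / q)"
      by (simp_all add: one_minus_Gmix Ebar_def Ecdf_def)
    then show ?thesis by (simp only: mult_le_cancel_left_pos exp_gt_zero)
  qed
  then show ?thesis by blast
qed

abbreviation "T \<equiv> Tq q (Gmix F)"

lemma T_eq: "T = Inf (ereal ` {t. 1 / q \<le> tilt F t})"
  unfolding crossing_set[symmetric] Tq_def by (simp add: setcompr_eq_image)

lemma tilt_below_T: "ereal t < T \<Longrightarrow> tilt F t < 1 / q"
  using Inf_lower[of "ereal t" "ereal ` {t. 1 / q \<le> tilt F t}"] unfolding T_eq[symmetric]
  by (rule_tac ccontr) (auto simp: not_less)

lemma tilt_above_T:
  assumes "T < ereal t" shows "1 / q \<le> tilt F t"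
proof -
  obtain s where "1 / q \<le> tilt F s" "s < t"
    using assms unfolding T_eq Inf_less_iff by auto
  then show ?thesis using tilt_mono[of s t] by simp
qed

lemma T_nonneg: "0 \<le> T"
  unfolding T_eq
proof (rule Inf_greatest, clarify)
  fix t assume t: "1 / q \<le> tilt F t"
  have "1 < 1 / q" using q by simp
  with t tilt_mono[of t 0] tilt_0 show "0 \<le> ereal t" by (cases "t \<le> 0") auto
qed

text \<open>The tilt is below \<open>1/q\<close> to the left of the threshold and at least
  \<open>1/q\<close> to its right; continuity forces equality at the threshold.\<close>

lemma tilt_T:
  assumes "T = ereal t" shows "tilt F t = 1 / q"
proof (rule antisym)
  have "(tilt F \<longlongrightarrow> tilt F t) (at t)"
    using isCont_tilt[of t] by (simp add: isCont_def)
  then have l: "(tilt F \<longlongrightarrow> tilt F t) (at_left t)" and r: "(tilt F \<longlongrightarrow> tilt F t) (at_right t)"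
    by (auto simp: filterlim_at_split)
  show "tilt F t \<le> 1 / q"
    using l by (rule tendsto_upperbound)
      (auto simp: eventually_at_filter assms intro!: always_eventually less_imp_le[OF tilt_below_T])
  show "1 / q \<le> tilt F t"
    using r by (rule tendsto_lowerbound)
      (auto simp: eventually_at_filter assms intro!: always_eventually tilt_above_T)
qed

lemma T_pos:
  assumes "T = ereal t" shows "0 < t"
  using tilt_T[OF assms] T_nonneg q tilt_0 unfolding assms by (cases "t = 0") auto

text \<open>If means bounded away from 1 had positive probability, the tilt would grow exponentially
  and reach \<open>1/q\<close>. Hence an infinite threshold occurs only for the point mass at 1,
  where ln \<mu> = 0 and always estimating 1 is free of error.\<close>

lemma AE_eq_1_of_T_infinite:
  assumes "T = \<infinity>" shows "AE \<mu> in F. \<mu> = 1"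
proof -
  have "AE \<mu> in F. 1 - 1 / \<mu> < 1 / real (Suc k)" for k
  proof -
    define c where "c = 1 / real (Suc k)"
    define A where "A = {\<mu>. c \<le> 1 - 1 / \<mu>}"
    have c: "0 < c" by (simp add: c_def)
    have [measurable]: "A \<in> sets F" unfolding A_def by measurable
    \<comment> \<open>Markov's inequality for the tilt at time \<open>n\<close>, which stays below
      \<open>1/q\<close> for every \<open>n\<close>.\<close>
    have "prob A \<le> exp (- real n * c) / q" for n :: nat
    proof -
      have "exp (real n * c) * prob A = (\<integral>\<mu>. exp (real n * c) * indicator A \<mu> \<partial>F)"
        by simp
      also have "\<dots> \<le> tilt F (real n)"
        unfolding tilt_def
      proof (rule integral_mono)
        show "integrable F (\<lambda>\<mu>. exp (real n * c) * indicator A \<mu>)"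
          by (simp add: less_top[symmetric])
      qed (auto simp: indicator_def A_def intro!: mult_left_mono)
      also have "\<dots> \<le> 1 / q" by (rule less_imp_le[OF tilt_below_T]) (simp add: assms)
      finally have "exp (- real n * c) * (exp (real n * c) * prob A) \<le> exp (- real n * c) * (1 / q)"
        by (rule mult_left_mono) simp
      then show ?thesis by (simp add: mult.assoc[symmetric] exp_add[symmetric] del: mult.assoc)
    qed
    moreover have "(\<lambda>n::nat. exp (- real n * c) / q) \<longlonglongrightarrow> 0"
      using c q by real_asymp
    ultimately have "prob A \<le> 0"
      by (intro tendsto_lowerbound[of _ 0 sequentially]) auto
    then have "prob A = 0" by (simp add: measure_le_0_iff)
    then have "AE \<mu> in F. \<mu> \<notin> A"
      by (simp add: prob_eq_0)
    then show ?thesis by eventually_elim (simp add: A_def c_def not_le)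
  qed
  then have "AE \<mu> in F. \<forall>k. 1 - 1 / \<mu> < 1 / real (Suc k)"
    by (simp add: AE_all_countable)
  with AE_ge_1 show ?thesis
  proof eventually_elim
    case (elim \<mu>)
    have "1 - 1 / \<mu> \<le> 0"
    proof (rule ccontr)
      assume "\<not> ?thesis"
      then obtain k where "1 / real (Suc k) < 1 - 1 / \<mu>"
        using nat_approx_posE[of "1 - 1 / \<mu>"] by auto
      with elim show False by (auto simp: not_less dest: less_asym)
    qed
    with elim show ?case by (simp add: field_simps)
  qed
qed

end

text \<open>A single function dominating the loss of every threshold up to \<open>U\<close>: an
  observation that is kept costs the first square, and one that is replaced by 1 costs
  \<open>(ln \<mu>)\<^sup>2\<close> and lies below \<open>U\<close>.\<close>

definition envelope :: "ereal \<Rightarrow> real \<times> real \<Rightarrow> real" where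
  "envelope U z = (ln (snd z) - ln (fst z))\<^sup>2 + (ln (fst z))\<^sup>2 * indicator {x. ereal x < U} (snd z)"

lemma borel_measurable_envelope [measurable]: "envelope U \<in> borel_measurable (borel \<Otimes>\<^sub>M borel)"
proof -
  have [measurable]: "{x. ereal x < U} \<in> sets borel" by measurable
  show ?thesis unfolding envelope_def by measurable
qed

lemma envelope_nonneg: "0 \<le> envelope U z"
  by (simp add: envelope_def)

lemma envelope_sq_le:
  "(envelope U z)\<^sup>2 \<le> 2 * (ln (snd z) - ln (fst z)) ^ 4 + 2 * ((ln (fst z)) ^ 4 * indicator {x. ereal x < U} (snd z))"
proof -
  have "(a\<^sup>2 + b\<^sup>2)\<^sup>2 \<le> 2 * a ^ 4 + 2 * b ^ 4" for a b :: real
    using sum_squares_ge_zero[of "a\<^sup>2 - b\<^sup>2" 0] by (simp add: power2_eq_square power4_eq_xxxx algebra_simps)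
  from this[of "ln (snd z) - ln (fst z)" "ln (fst z)"] this[of "ln (snd z) - ln (fst z)" 0]
  show ?thesis by (auto simp: envelope_def indicator_def)
qed

text \<open>Linear growth in \<open>m\<close> is exactly what the factor \<open>1/m\<close> from
  \<open>exponential_density_below\<close> cancels; 256 = 4^4.\<close>

lemma ln_pow4_le_linear:
  fixes m :: real assumes "1 \<le> m" shows "(ln m) ^ 4 \<le> 256 * m"
proof -
  have "ln m \<le> 4 * m powr (1/4)"
    using ln_le_powr_mult[of m "1/4"] assms by simp
  then have "(ln m) ^ 4 \<le> (4 * m powr (1/4)) ^ 4"
    using assms by (intro power_mono) auto
  also have "\<dots> = 256 * m"
    using assms by (simp add: power_mult_distrib powr_power)
  finally show ?thesis .
qed

text \<open>Conditioning on the mean splits off the scale-free part, bounded by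
  \<open>log_moment\<close>. What remains is \<open>(ln m) ^ 4\<close> times the conditional
  probability of an observation below \<open>U\<close>, and \<open>g\<close> is left open because it
  is bounded in two different ways below.\<close>

lemma (in mixing) envelope_moment:
  assumes [measurable]: "g \<in> borel_measurable F"
    and g: "AE m in F. 1 \<le> m \<longrightarrow> ennreal ((ln m) ^ 4) *
      (\<integral>\<^sup>+x. ennreal (exponential_density (1 / m) x) * indicator {x. ereal x < U} x \<partial>lborel) \<le> g m"
  shows "(\<integral>\<^sup>+z. ennreal ((envelope U z)\<^sup>2) \<partial>pairlaw F) \<le> ennreal (2 * log_moment) + 2 * (\<integral>\<^sup>+m. g m \<partial>F)"
proof -
  have [measurable]: "{x. ereal x < U} \<in> sets borel" by measurable
  let ?I = "indicator {x. ereal x < U}"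
  have "(\<integral>\<^sup>+z. ennreal ((envelope U z)\<^sup>2) \<partial>pairlaw F)
     \<le> (\<integral>\<^sup>+z. 2 * ennreal ((ln (snd z) - ln (fst z)) ^ 4) + 2 * (ennreal ((ln (fst z)) ^ 4) * ?I (snd z)) \<partial>pairlaw F)"
  proof (rule nn_integral_mono)
    fix z
    have "ennreal ((envelope U z)\<^sup>2) \<le> ennreal (2 * (ln (snd z) - ln (fst z)) ^ 4 + 2 * ((ln (fst z)) ^ 4 * ?I (snd z)))"
      by (rule ennreal_leI[OF envelope_sq_le])
    also have "\<dots> = 2 * ennreal ((ln (snd z) - ln (fst z)) ^ 4) + 2 * (ennreal ((ln (fst z)) ^ 4) * ?I (snd z))"
      by (simp add: ennreal_mult indicator_def)
    finally show "ennreal ((envelope U z)\<^sup>2) \<le> \<dots>" .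
  qed
  also have "\<dots> = (\<integral>\<^sup>+m. \<integral>\<^sup>+x. ennreal (exponential_density (1 / m) x) *
      (2 * ennreal ((ln x - ln m) ^ 4) + 2 * (ennreal ((ln m) ^ 4) * ?I x)) \<partial>lborel \<partial>F)"
    by (subst nn_integral_pairlaw) auto
  also have "\<dots> \<le> (\<integral>\<^sup>+m. ennreal (2 * log_moment) + 2 * g m \<partial>F)"
  proof (rule nn_integral_mono_AE)
    show "AE m in F. (\<integral>\<^sup>+x. ennreal (exponential_density (1 / m) x) *
      (2 * ennreal ((ln x - ln m) ^ 4) + 2 * (ennreal ((ln m) ^ 4) * ?I x)) \<partial>lborel)
      \<le> ennreal (2 * log_moment) + 2 * g m"
      using g AE_ge_1
    proof eventually_elim
      case (elim m)
      have "(\<integral>\<^sup>+x. ennreal (exponential_density (1 / m) x) *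
        (2 * ennreal ((ln x - ln m) ^ 4) + 2 * (ennreal ((ln m) ^ 4) * ?I x)) \<partial>lborel)
       = (\<integral>\<^sup>+x. 2 * (ennreal (exponential_density (1 / m) x) * ennreal ((ln x - ln m) ^ 4))
          + 2 * (ennreal ((ln m) ^ 4) * (ennreal (exponential_density (1 / m) x) * ?I x)) \<partial>lborel)"
        by (intro nn_integral_cong) (simp add: distrib_left mult_ac)
      also have "\<dots> = 2 * (\<integral>\<^sup>+x. ennreal (exponential_density (1 / m) x) * ennreal ((ln x - ln m) ^ 4) \<partial>lborel)
        + 2 * (ennreal ((ln m) ^ 4) * (\<integral>\<^sup>+x. ennreal (exponential_density (1 / m) x) * ?I x \<partial>lborel))"
        by (subst nn_integral_add) (auto simp: nn_integral_cmult)
      also have "\<dots> \<le> 2 * ennreal log_moment + 2 * g m"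
        using elim by (intro add_mono mult_left_mono exponential_density_log_moment) auto
      finally show ?case by (simp add: ennreal_mult log_moment_nonneg)
    qed
  qed
  also have "\<dots> = ennreal (2 * log_moment) + 2 * (\<integral>\<^sup>+m. g m \<partial>F)"
    by (subst nn_integral_add) (auto simp: nn_integral_cmult)
  finally show ?thesis .
qed

text \<open>Here \<open>g\<close> is constant in \<open>m\<close>. At \<open>b = ln (n/q)\<close>,
  the cap of the empirical threshold, the bound grows only logarithmically in
  \<open>n\<close>.\<close>

lemma (in mixing) envelope_moment_linear:
  assumes b: "0 \<le> b"
  shows "(\<integral>\<^sup>+z. ennreal ((envelope (ereal b) z)\<^sup>2) \<partial>pairlaw F) \<le> ennreal (2 * log_moment + 512 * b)"
proof -
  have "(\<integral>\<^sup>+z. ennreal ((envelope (ereal b) z)\<^sup>2) \<partial>pairlaw F)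
      \<le> ennreal (2 * log_moment) + 2 * (\<integral>\<^sup>+m. ennreal (256 * b) \<partial>F)"
  proof (rule envelope_moment, measurable, intro AE_I2 impI)
    fix m :: real assume m: "1 \<le> m"
    have "ennreal ((ln m) ^ 4) * (\<integral>\<^sup>+x. ennreal (exponential_density (1 / m) x) * indicator {x. ereal x < ereal b} x \<partial>lborel)
       \<le> ennreal (256 * m) * ennreal (b * (1 / m))"
      using exponential_density_below[of "1 / m" b] m b
      by (intro mult_mono ennreal_leI ln_pow4_le_linear) auto
    also have "\<dots> = ennreal (256 * b)"
      using m b by (simp add: ennreal_mult[symmetric])
    finally show "ennreal ((ln m) ^ 4) * (\<integral>\<^sup>+x. ennreal (exponential_density (1 / m) x) * indicator {x. ereal x < ereal b} x \<partial>lborel)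
       \<le> ennreal (256 * b)" .
  qed
  also have "\<dots> = ennreal (2 * log_moment + 512 * b)"
    using b log_moment_nonneg by (simp add: ennreal_plus ennreal_mult)
  finally show ?thesis .
qed

text \<open>Here \<open>g\<close> is a multiple of the tilting exponential at the threshold, whose
  mean under \<open>F\<close> is \<open>1/q\<close>. The bound is thus free of \<open>F\<close> and
  of the size of the threshold; 16386 is twice the factor 8193 in \<open>g\<close>.\<close>

lemma (in fdr_mixing) envelope_moment_T:
  "(\<integral>\<^sup>+z. ennreal ((envelope (16 * T) z)\<^sup>2) \<partial>pairlaw F) \<le> ennreal (2 * log_moment + 16386 / q)"
proof (cases T)
  case PInf
  have "(\<integral>\<^sup>+z. ennreal ((envelope (16 * T) z)\<^sup>2) \<partial>pairlaw F) \<le> ennreal (2 * log_moment) + 2 * (\<integral>\<^sup>+m. 0 \<partial>F)"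
    using AE_eq_1_of_T_infinite[OF PInf] by (intro envelope_moment) auto
  also have "\<dots> \<le> ennreal (2 * log_moment + 16386 / q)"
    using q by (auto intro!: ennreal_leI)
  finally show ?thesis .
next
  case MInf
  then show ?thesis using T_nonneg by simp
next
  case (real t)
  have t: "0 < t" "tilt F t = 1 / q" using T_pos[OF real] tilt_T[OF real] by auto
  have U: "16 * T = ereal (16 * t)" by (simp add: real)
  have "(\<integral>\<^sup>+z. ennreal ((envelope (16 * T) z)\<^sup>2) \<partial>pairlaw F)
      \<le> ennreal (2 * log_moment) + 2 * (\<integral>\<^sup>+m. ennreal (8193 * exp (t * (1 - 1 / m))) \<partial>F)"
    unfolding U
  proof (rule envelope_moment, measurable, intro AE_I2 impI)
    fix m :: real assume m: "1 \<le> m"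
    let ?I = "\<integral>\<^sup>+x. ennreal (exponential_density (1 / m) x) * indicator {x. ereal x < ereal (16 * t)} x \<partial>lborel"
    show "ennreal ((ln m) ^ 4) * ?I \<le> ennreal (8193 * exp (t * (1 - 1 / m)))"
    \<comment> \<open>Below 2 the logarithm is at most 1 and the exponential at least 1. From 2 on,
      \<open>1 - 1 / m \<ge> 1 / 2\<close>, so the exponential absorbs the linear factor
      \<open>t\<close>. The constant 8193 serves both cases.\<close>
    proof (cases "m < 2")
      case True
      have "?I \<le> (\<integral>\<^sup>+x. ennreal (exponential_density (1 / m) x) * indicator {0..} x \<partial>lborel)"
        by (intro nn_integral_mono) (auto simp: indicator_def exponential_density_def)
      also have "\<dots> = 1"
        using m by (subst exponential_density_tail) auto
      finally have I: "?I \<le> 1" .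
      have "ln m \<le> ln 2" "0 \<le> ln m" using m True by auto
      then have "(ln m) ^ 4 \<le> 1" using ln_2_less_1 by (intro power_le_one) auto
      also have "1 \<le> exp (t * (1 - 1 / m))" using m t by simp
      also have "\<dots> \<le> 8193 * exp (t * (1 - 1 / m))" by simp
      finally have "ennreal ((ln m) ^ 4) \<le> ennreal (8193 * exp (t * (1 - 1 / m)))"
        by (rule ennreal_leI)
      from mult_mono[OF this I] show ?thesis by simp
    next
      case False
      have "ennreal ((ln m) ^ 4) * ?I \<le> ennreal (256 * m) * ennreal (16 * t * (1 / m))"
        using exponential_density_below[of "1 / m" "16 * t"] m t
        by (intro mult_mono ennreal_leI ln_pow4_le_linear) auto
      \<comment> \<open>The product 256 * 16 * t, written with \<open>t / 2\<close> to be compared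
        with \<open>exp (t / 2)\<close>.\<close>
      also have "\<dots> = ennreal (8192 * (t / 2))"
        using m t by (simp add: ennreal_mult[symmetric])
      also have "\<dots> \<le> ennreal (8193 * exp (t * (1 - 1 / m)))"
      proof (intro ennreal_leI mult_mono)
        have "t / 2 \<le> exp (t / 2)" using exp_ge_add_one_self[of "t / 2"] by linarith
        also have "exp (t / 2) \<le> exp (t * (1 - 1 / m))"
        proof (subst exp_le_cancel_iff)
          have "1 / 2 \<le> 1 - 1 / m" using False by (simp add: field_simps)
          from mult_left_mono[OF this, of t] show "t / 2 \<le> t * (1 - 1 / m)" using t by simp
        qed
        finally show "t / 2 \<le> exp (t * (1 - 1 / m))" .
      qed (use t in auto)
      finally show ?thesis .
    qed
  qed
  also have "(\<integral>\<^sup>+m. ennreal (8193 * exp (t * (1 - 1 / m))) \<partial>F) = ennreal (8193 / q)"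
    using t by (subst nn_integral_eq_integral) (auto simp: tilt_def)
  also have "ennreal (2 * log_moment) + 2 * ennreal (8193 / q) = ennreal (2 * log_moment + 16386 / q)"
    using q log_moment_nonneg ennreal_mult[of 2 "8193 / q"] by (simp add: ennreal_plus)
  finally show ?thesis .
qed

section \<open>The empirical threshold\<close>

text \<open>A sum of indicators, the form to which Hoeffding's inequality applies. The half-line is
  closed because \<open>Gemp\<close> counts with a strict inequality.\<close>

definition exceed :: "nat \<Rightarrow> (nat \<Rightarrow> real) \<Rightarrow> real \<Rightarrow> real" where
  "exceed n X t = (\<Sum>i<n. indicator {t..} (X i))"

text \<open>The empirical tail is a step function with values \<open>k/n\<close>, so it can first reach \<open>exp (-t) / q\<close>
  only where \<open>exp (-t) = q k / n\<close>; the default threshold \<open>ln (n/q)\<close> is the case \<open>k = 1\<close>.\<close>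

definition grid :: "real \<Rightarrow> nat \<Rightarrow> nat \<Rightarrow> real" where
  "grid q n k = ln (real n / (q * real k))"

lemma exceed_eq_card: "exceed n X t = real (card {i \<in> {..<n}. t \<le> X i})"
proof -
  have "exceed n X t = (\<Sum>i\<in>{i \<in> {..<n}. t \<le> X i}. 1)"
    unfolding exceed_def by (intro sum.mono_neutral_cong_right) (auto simp: indicator_def)
  then show ?thesis by simp
qed

lemma exceed_antimono: "s \<le> t \<Longrightarrow> exceed n X t \<le> exceed n X s"
  unfolding exceed_eq_card by (intro of_nat_mono card_mono) auto

lemma one_minus_Gemp:
  assumes "0 < n" shows "1 - Gemp n X t = exceed n X t / real n"
proof -
  have "card {i \<in> {..<n}. X i < t} + card {i \<in> {..<n}. t \<le> X i} =
      card ({i \<in> {..<n}. X i < t} \<union> {i \<in> {..<n}. t \<le> X i})"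
    by (rule card_Un_disjoint[symmetric]) auto
  also have "{i \<in> {..<n}. X i < t} \<union> {i \<in> {..<n}. t \<le> X i} = {..<n}"
    by auto
  finally have "real (card {i \<in> {..<n}. X i < t}) + real (card {i \<in> {..<n}. t \<le> X i}) = real n"
    by (simp flip: of_nat_add)
  then show ?thesis
    using assms by (simp add: Gemp_def exceed_eq_card field_simps)
qed

section \<open>Reduction of the empirical threshold to finitely many levels\<close>

context
  fixes q :: real and n :: nat
  assumes q: "0 < q" "q < 1" and n: "0 < n"
begin

lemma grid_nonneg: "k \<in> {1..n} \<Longrightarrow> 0 \<le> grid q n k"
  unfolding grid_def using q mult_mono[of q 1 "real k" "real n"]
  by (intro ln_ge_zero) (auto simp: field_simps)

lemma exp_grid: "1 \<le> k \<Longrightarrow> exp (- grid q n k) = q * real k / real n"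
  unfolding grid_def exp_minus using q n by (subst exp_ln) auto

lemma grid_le_grid_1: "k \<in> {1..n} \<Longrightarrow> grid q n k \<le> grid q n 1"
  unfolding grid_def using q n by (intro ln_mono) (auto simp: field_simps)

lemma grid_in_crossing:
  assumes k: "k \<in> {1..n}" "real k \<le> exceed n X (grid q n k)"
  shows "1 - Gemp n X (grid q n k) \<ge> Ebar (grid q n k) / q"
  using k q n grid_nonneg[OF k(1)] exp_grid[of k]
  by (simp add: one_minus_Gemp Ebar_def Ecdf_def divide_right_mono)

text \<open>With \<open>k\<close> observations at or above \<open>t\<close>, the crossing condition
  reads \<open>exp (- t) \<le> q * k / n\<close>, that is, \<open>grid q n k \<le> t\<close>. Moving
  left to that grid point can only raise the count, so the condition holds there too.\<close>

lemma crossing_grid: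
  assumes t: "1 - Gemp n X t \<ge> Ebar t / q"
  obtains k where "k \<in> {1..n}" "real k \<le> exceed n X (grid q n k)" "grid q n k \<le> t"
proof -
  define k where "k = card {i \<in> {..<n}. t \<le> X i}"
  have k: "exceed n X t = real k" by (simp add: k_def exceed_eq_card)
  have kn: "k \<le> n" unfolding k_def using card_mono[of "{..<n}" "{i \<in> {..<n}. t \<le> X i}"] by auto
  have le: "Ebar t / q \<le> real k / real n"
    using t by (simp add: one_minus_Gemp n k)
  have t0: "0 \<le> t"
  proof (rule ccontr)
    assume "\<not> 0 \<le> t"
    then have "1 / q \<le> real k / real n" using le by (simp add: Ebar_def Ecdf_def)
    also have "\<dots> \<le> 1" using kn n by simp
    finally show False using q by simp
  qed
  then have e: "exp (- t) \<le> q * real k / real n"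
    using le q by (simp add: Ebar_def Ecdf_def field_simps)
  have k1: "1 \<le> k"
  proof (rule ccontr)
    assume "\<not> 1 \<le> k"
    then have "k = 0" by simp
    with e have "exp (- t) \<le> 0" by simp
    then show False using exp_gt_zero[of "- t"] by linarith
  qed
  have "exp (- t) \<le> exp (- grid q n k)"
    using e by (simp add: exp_grid[OF k1])
  then have g: "grid q n k \<le> t" by simp
  show ?thesis
    using that[of k] k1 kn g exceed_antimono[OF g, of n X] k by auto
qed

text \<open>An infimum over a continuum becomes a minimum of \<open>n\<close> explicit random
  variables, which yields measurability and the bounds below. The default \<open>ln (n/q)\<close> is
  \<open>grid q n 1\<close>, the largest grid value, so indices without a crossing may take it and
  leave the minimum unchanged.\<close>

lemma That_eq_Min:
  "That q n X = Min ((\<lambda>k. if real k \<le> exceed n X (grid q n k) then grid q n k else grid q n 1) ` {1..n})"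
    (is "_ = Min (?f ` _)")
proof -
  have fin: "finite (?f ` {1..n})" by simp
  have ne: "?f ` {1..n} \<noteq> {}" unfolding image_is_empty using n by simp
  let ?S = "{t. 1 - Gemp n X t \<ge> Ebar t / q}"
  have Tq: "Tq q (Gemp n X) = Inf (ereal ` ?S)"
    unfolding Tq_def by (simp add: setcompr_eq_image)
  show ?thesis
  proof (cases "?S = {}")
    case True
    have f: "?f k = grid q n 1" if "k \<in> {1..n}" for k
      using grid_in_crossing[of k X] True that by auto
    have "?f ` {1..n} = (\<lambda>_. grid q n 1) ` {1..n}"
      by (rule image_cong[OF refl f])
    also have "\<dots> = {grid q n 1}" using n by (simp add: image_constant_conv)
    finally have "Min (?f ` {1..n}) = grid q n 1" by simp
    moreover have "That q n X = grid q n 1"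
      unfolding That_def Tq True by (simp add: top_ereal_def grid_def)
    ultimately show ?thesis by simp
  next
    case False
    have "Tq q (Gemp n X) = ereal (Min (?f ` {1..n}))"
    proof (rule antisym)
      show "ereal (Min (?f ` {1..n})) \<le> Tq q (Gemp n X)"
        unfolding Tq
      proof (rule Inf_greatest, clarify)
        fix t assume "1 - Gemp n X t \<ge> Ebar t / q"
        then obtain k where k: "k \<in> {1..n}" "real k \<le> exceed n X (grid q n k)" "grid q n k \<le> t"
          by (rule crossing_grid)
        have "Min (?f ` {1..n}) \<le> ?f k" using k fin by (intro Min_le) auto
        also have "\<dots> \<le> t" using k by simp
        finally show "ereal (Min (?f ` {1..n})) \<le> ereal t" by simp
      qed
      obtain k where k: "k \<in> {1..n}" "Min (?f ` {1..n}) = ?f k"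
        using Min_in[OF fin ne] by blast
      obtain t where "1 - Gemp n X t \<ge> Ebar t / q" using False by blast
      then obtain j where j: "j \<in> {1..n}" "real j \<le> exceed n X (grid q n j)"
        by (rule crossing_grid)
      \<comment> \<open>If the minimizing index \<open>k\<close> is not a crossing, its value is
        \<open>grid q n 1\<close>, and the crossing \<open>j\<close> lies no higher.\<close>
      have "\<exists>i\<in>{1..n}. real i \<le> exceed n X (grid q n i) \<and> grid q n i \<le> ?f k"
        using k j grid_le_grid_1[OF j(1)] by auto
      then obtain i where i: "i \<in> {1..n}" "real i \<le> exceed n X (grid q n i)" "grid q n i \<le> ?f k"
        by blast
      have "Tq q (Gemp n X) \<le> ereal (grid q n i)"
        unfolding Tq by (rule Inf_lower) (use grid_in_crossing[OF i(1,2)] in auto)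
      also have "\<dots> \<le> ereal (Min (?f ` {1..n}))" using i k by simp
      finally show "Tq q (Gemp n X) \<le> ereal (Min (?f ` {1..n}))" .
    qed
    then show ?thesis by (simp add: That_def)
  qed
qed

lemma That_le_grid_1: "That q n X \<le> grid q n 1"
proof -
  have "That q n X \<le> (if real 1 \<le> exceed n X (grid q n 1) then grid q n 1 else grid q n 1)"
    unfolding That_eq_Min using n by (intro Min_le) (auto intro!: image_eqI[of _ _ 1])
  then show ?thesis by simp
qed

text \<open>The cap on \<open>s\<close> rules out the default value, so an undershoot is traced to a
  genuine crossing at one of \<open>n\<close> fixed levels, ready for a union bound.\<close>

lemma That_less_imp:
  assumes "That q n X < s" "s \<le> grid q n 1"
  obtains k where "k \<in> {1..n}" "real k \<le> exceed n X (grid q n k)" "grid q n k < s"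
proof -
  have "\<exists>k\<in>{1..n}. (if real k \<le> exceed n X (grid q n k) then grid q n k else grid q n 1) < s"
    using assms(1) n unfolding That_eq_Min
    by (subst (asm) Min_less_iff) (simp, simp only: image_is_empty, simp, blast)
  then show ?thesis using that assms(2) by (auto split: if_splits)
qed

text \<open>Enough exceedances at one level already stop the threshold there, so an overshoot is
  controlled by a single count.\<close>

lemma That_le:
  assumes s: "0 \<le> s" "real n * exp (- s) / q \<le> exceed n X s"
  shows "That q n X \<le> s"
proof -
  have "1 - Gemp n X s \<ge> Ebar s / q"
    using s n by (simp add: one_minus_Gemp Ebar_def Ecdf_def field_simps)
  then obtain k where k: "k \<in> {1..n}" "real k \<le> exceed n X (grid q n k)" "grid q n k \<le> s"
    by (rule crossing_grid)
  have "That q n X \<le> (if real k \<le> exceed n X (grid q n k) then grid q n k else grid q n 1)"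
    unfolding That_eq_Min using k by (intro Min_le) auto
  with k show ?thesis by simp
qed

end

section \<open>The sample space and concentration of the empirical threshold\<close>

locale fdr_sample = fdr_mixing +
  fixes n :: nat
  assumes n: "0 < n"
begin

abbreviation "P \<equiv> PiM {..<n} (\<lambda>_. pairlaw F)"
abbreviation "obs \<omega> \<equiv> (\<lambda>j. snd (\<omega> j :: real \<times> real))"

lemma prob_space_P: "prob_space P"
  by (intro prob_space_PiM prob_space_pairlaw)

sublocale P: prob_space P by (rule prob_space_P)

lemma measurable_component: "i < n \<Longrightarrow> (\<lambda>\<omega>. \<omega> i) \<in> P \<rightarrow>\<^sub>M pairlaw F"
  by (rule measurable_component_singleton) simp

lemma measurable_fst_component: "i < n \<Longrightarrow> (\<lambda>\<omega>. fst (\<omega> i)) \<in> borel_measurable P"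
  and measurable_snd_component: "i < n \<Longrightarrow> (\<lambda>\<omega>. snd (\<omega> i)) \<in> borel_measurable P"
  by (rule measurable_compose[OF measurable_component], simp, measurable)+

lemma measurable_exceed [measurable]: "(\<lambda>\<omega>. exceed n (obs \<omega>) t) \<in> borel_measurable P"
  unfolding exceed_def
  by (intro borel_measurable_sum measurable_compose[OF measurable_snd_component]) auto

lemma measurable_That [measurable]: "(\<lambda>\<omega>. That q n (obs \<omega>)) \<in> borel_measurable P"
  unfolding That_eq_Min[OF q n] by (rule borel_measurable_Min) auto

lemma distr_component: "i < n \<Longrightarrow> distr P (pairlaw F) (\<lambda>\<omega>. \<omega> i) = pairlaw F"
  by (rule distr_PiM_component) (auto intro: prob_space_pairlaw)

lemma integral_component:
  fixes f :: "real \<times> real \<Rightarrow> real"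
  assumes i: "i < n" and [measurable]: "f \<in> borel_measurable (borel \<Otimes>\<^sub>M borel)"
  shows "(\<integral>\<omega>. f (\<omega> i) \<partial>P) = (\<integral>z. f z \<partial>pairlaw F)"
proof -
  have "(\<integral>z. f z \<partial>pairlaw F) = (\<integral>z. f z \<partial>distr P (pairlaw F) (\<lambda>\<omega>. \<omega> i))"
    using i by (simp add: distr_component)
  also have "\<dots> = (\<integral>\<omega>. f (\<omega> i) \<partial>P)"
    using i by (intro integral_distr measurable_component) measurable
  finally show ?thesis ..
qed

lemma nn_integral_component:
  assumes i: "i < n" and [measurable]: "f \<in> borel_measurable (borel \<Otimes>\<^sub>M borel)"
  shows "(\<integral>\<^sup>+\<omega>. f (\<omega> i) \<partial>P) = (\<integral>\<^sup>+z. f z \<partial>pairlaw F)"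
proof -
  have "(\<integral>\<^sup>+z. f z \<partial>pairlaw F) = (\<integral>\<^sup>+z. f z \<partial>distr P (pairlaw F) (\<lambda>\<omega>. \<omega> i))"
    using i by (simp add: distr_component)
  also have "\<dots> = (\<integral>\<^sup>+\<omega>. f (\<omega> i) \<partial>P)"
    using i by (intro nn_integral_distr measurable_component) measurable
  finally show ?thesis ..
qed

lemma prob_component:
  assumes i: "i < n" and A: "A \<in> sets (borel \<Otimes>\<^sub>M borel)"
  shows "P.prob {\<omega> \<in> space P. \<omega> i \<in> A} = measure (pairlaw F) A"
proof -
  have "measure (pairlaw F) A = measure (distr P (pairlaw F) (\<lambda>\<omega>. \<omega> i)) A"
    using i by (simp add: distr_component)
  also have "\<dots> = P.prob ((\<lambda>\<omega>. \<omega> i) -` A \<inter> space P)"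
    using i A by (intro measure_distr measurable_component) (auto simp: sets_pairlaw)
  also have "(\<lambda>\<omega>. \<omega> i) -` A \<inter> space P = {\<omega> \<in> space P. \<omega> i \<in> A}" by auto
  finally show ?thesis ..
qed

lemma indep_components: "P.indep_vars (\<lambda>_. pairlaw F) (\<lambda>i \<omega>. \<omega> i) {..<n}"
proof (subst P.indep_vars_iff_distr_eq_PiM')
  have "distr P P (\<lambda>\<omega>. restrict \<omega> {..<n}) = distr P P (\<lambda>\<omega>. \<omega>)"
    by (intro distr_cong refl) (auto simp: space_PiM PiE_iff extensional_restrict)
  also have "\<dots> = P" by (rule distr_id)
  also have "P = PiM {..<n} (\<lambda>i. distr P (pairlaw F) (\<lambda>\<omega>. \<omega> i))"
    by (intro PiM_cong) (auto simp: distr_component)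
  finally show "distr P P (\<lambda>x. \<lambda>i\<in>{..<n}. x i) = PiM {..<n} (\<lambda>i. distr P (pairlaw F) (\<lambda>\<omega>. \<omega> i))" .
  show "(\<lambda>\<omega>. \<omega> i) \<in> P \<rightarrow>\<^sub>M pairlaw F" if "i \<in> {..<n}" for i
    by (rule measurable_component_singleton[OF that])
  show "{..<n} \<noteq> {}" using n by (simp add: lessThan_empty_iff)
qed

text \<open>Hoeffding's inequality for \<open>n\<close> independent indicators with mean
  \<open>exp (- t) * tilt F t\<close>; the right sides do not involve \<open>F\<close>.\<close>

lemma exceed_concentration:
  assumes t: "0 \<le> t" and e: "0 \<le> e"
  shows "P.prob {\<omega> \<in> space P. exceed n (obs \<omega>) t \<ge> real n * (exp (- t) * tilt F t + e)} \<le> exp (- 2 * real n * e\<^sup>2)" (is ?A)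
    and "P.prob {\<omega> \<in> space P. exceed n (obs \<omega>) t \<le> real n * (exp (- t) * tilt F t - e)} \<le> exp (- 2 * real n * e\<^sup>2)" (is ?B)
proof -
  let ?X = "\<lambda>i \<omega>. indicator {t..} (snd (\<omega> i :: real \<times> real)) :: real"
  have E: "P.expectation (?X i) = exp (- t) * tilt F t" if "i < n" for i
  proof -
    have "{z \<in> space (pairlaw F). t \<le> snd z} \<in> sets (pairlaw F)" by measurable
    then have [measurable]: "{z. t \<le> snd z} \<in> sets (pairlaw F)" by simp
    have "P.expectation (?X i) = (\<integral>z. indicator {t..} (snd z) \<partial>pairlaw F)"
      by (rule integral_component[OF that]) measurable
    also have "\<dots> = (\<integral>z. indicator {z. t \<le> snd z} z \<partial>pairlaw F)"
      by (rule Bochner_Integration.integral_cong) (auto simp: indicator_def)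
    also have "\<dots> = exp (- t) * tilt F t"
      by (simp add: pairlaw_tail[OF t])
    finally show ?thesis .
  qed
  interpret H: Hoeffding_ineq P "{..<n}" ?X "\<lambda>_. 0" "\<lambda>_. 1" "\<Sum>i<n. P.expectation (?X i)"
  proof unfold_locales
    show "P.indep_vars (\<lambda>_. borel) ?X {..<n}"
      by (rule P.indep_vars_compose2[OF indep_components]) measurable
  qed (auto simp: indicator_def)
  have mu: "(\<Sum>i<n. P.expectation (?X i)) = real n * (exp (- t) * tilt F t)"
    by (simp add: E)
  have ex: "exp (- 2 * (real n * e)\<^sup>2 / (\<Sum>i<n. (1 - 0)\<^sup>2)) = exp (- 2 * real n * e\<^sup>2)"
    using n by (simp add: power2_eq_square)
  have "0 \<le> real n * e" "(\<Sum>i<n. (1 - 0 :: real)\<^sup>2) > 0" using e n by auto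
  note H = H.Hoeffding_ineq_ge[OF this] H.Hoeffding_ineq_le[OF this]
  show ?A using H(1) unfolding mu ex by (simp add: exceed_def distrib_left)
  show ?B using H(2) unfolding mu ex by (simp add: exceed_def right_diff_distrib)
qed

text \<open>An undershoot forces at least \<open>k\<close> exceedances at some grid level below
  \<open>s\<close>, where fewer are expected. One deviation rate serves all levels, and the union
  bound costs the factor \<open>n\<close>.\<close>

lemma prob_That_less:
  assumes s: "s \<le> grid q n 1" and tilt: "tilt F s < 1 / q"
  shows "P.prob {\<omega> \<in> space P. That q n (obs \<omega>) < s}
    \<le> real n * exp (- 2 * real n * (exp (- s) * (1 / q - tilt F s))\<^sup>2)"
proof -
  let ?g = "exp (- s) * (1 / q - tilt F s)"
  let ?K = "{k \<in> {1..n}. grid q n k < s}"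
  let ?A = "\<lambda>k. {\<omega> \<in> space P. real k \<le> exceed n (obs \<omega>) (grid q n k)}"
  have g: "0 \<le> ?g" using tilt by simp
  have "{\<omega> \<in> space P. That q n (obs \<omega>) < s} \<subseteq> (\<Union>k\<in>?K. ?A k)"
    by (auto elim!: That_less_imp[OF q n _ s])
  then have "P.prob {\<omega> \<in> space P. That q n (obs \<omega>) < s} \<le> P.prob (\<Union>k\<in>?K. ?A k)"
    by (intro P.finite_measure_mono) auto
  also have "\<dots> \<le> (\<Sum>k\<in>?K. P.prob (?A k))"
    by (intro P.finite_measure_subadditive_finite) auto
  also have "\<dots> \<le> (\<Sum>k\<in>?K. exp (- 2 * real n * ?g\<^sup>2))"
  proof (rule sum_mono)
    fix k assume k: "k \<in> ?K"
    let ?t = "grid q n k"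
    have t: "0 \<le> ?t" "exp (- ?t) = q * real k / real n"
      using grid_nonneg[OF q n] exp_grid[OF q n] k by auto
    \<comment> \<open>Both \<open>exp (- t)\<close> and \<open>1 / q - tilt F t\<close> decrease in
      \<open>t\<close>, so their product at a grid level below \<open>s\<close> is at least its
      value \<open>?g\<close> at \<open>s\<close>.\<close>
    have "real n * (exp (- ?t) * tilt F ?t + ?g) \<le> real n * (exp (- ?t) * tilt F ?t + exp (- ?t) * (1 / q - tilt F ?t))"
      using k tilt tilt_mono[of ?t s] by (intro mult_left_mono add_left_mono mult_mono) auto
    also have "\<dots> = real n * (exp (- ?t) * (1 / q))" by (simp add: algebra_simps)
    also have "\<dots> = real k" unfolding t(2) using q n by simp
    finally have "P.prob (?A k) \<le> P.prob {\<omega> \<in> space P. exceed n (obs \<omega>) ?t \<ge> real n * (exp (- ?t) * tilt F ?t + ?g)}"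
      by (intro P.finite_measure_mono) auto
    also have "\<dots> \<le> exp (- 2 * real n * ?g\<^sup>2)"
      by (rule exceed_concentration(1)[OF t(1) g])
    finally show "P.prob (?A k) \<le> exp (- 2 * real n * ?g\<^sup>2)" .
  qed
  also have "\<dots> \<le> real n * exp (- 2 * real n * ?g\<^sup>2)"
    using card_mono[of "{1..n}" ?K] by (simp add: subset_iff)
  finally show ?thesis .
qed

text \<open>By \<open>That_le\<close> the threshold passes \<open>s\<close> only if the count there
  falls short of \<open>n * exp (- s) / q\<close>, which lies below its mean by \<open>n\<close>
  times \<open>?g\<close>.\<close>

lemma prob_That_greater:
  assumes s: "0 \<le> s" and tilt: "1 / q \<le> tilt F s"
  shows "P.prob {\<omega> \<in> space P. s < That q n (obs \<omega>)}
    \<le> exp (- 2 * real n * (exp (- s) * (tilt F s - 1 / q))\<^sup>2)"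
proof -
  let ?g = "exp (- s) * (tilt F s - 1 / q)"
  have "real n * (exp (- s) * tilt F s - ?g) = real n * exp (- s) / q"
    by (simp add: algebra_simps)
  then have "{\<omega> \<in> space P. s < That q n (obs \<omega>)} \<subseteq>
      {\<omega> \<in> space P. exceed n (obs \<omega>) s \<le> real n * (exp (- s) * tilt F s - ?g)}"
    using That_le[OF q n s] by (force simp: not_less dest: leD intro: leI)
  then have "P.prob {\<omega> \<in> space P. s < That q n (obs \<omega>)} \<le>
      P.prob {\<omega> \<in> space P. exceed n (obs \<omega>) s \<le> real n * (exp (- s) * tilt F s - ?g)}"
    by (intro P.finite_measure_mono) auto
  also have "\<dots> \<le> exp (- 2 * real n * ?g\<^sup>2)"
    using tilt by (intro exceed_concentration(2)[OF s]) simp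
  finally show ?thesis .
qed

end

section \<open>Comparison of the risks\<close>

definition loss :: "ereal \<Rightarrow> real \<times> real \<Rightarrow> real" where
  "loss t z = (ln (delta t (snd z)) - ln (fst z))\<^sup>2"

definition separates :: "ereal \<Rightarrow> ereal \<Rightarrow> real \<Rightarrow> bool" where
  "separates s t x \<longleftrightarrow> (s \<le> ereal x) \<noteq> (t \<le> ereal x)"

lemma loss_nonneg: "0 \<le> loss t z"
  by (simp add: loss_def)

lemma loss_le_envelope: "t \<le> U \<Longrightarrow> loss t z \<le> envelope U z"
  by (auto simp: loss_def delta_def envelope_def indicator_def not_le)

lemma loss_diff_le:
  assumes "s \<le> U" "t \<le> U"
  shows "\<bar>loss s z - loss t z\<bar> \<le> envelope U z * of_bool (separates s t (snd z))"
proof (cases "separates s t (snd z)")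
  case True
  then show ?thesis
    using loss_le_envelope[OF assms(1), of z] loss_le_envelope[OF assms(2), of z]
      loss_nonneg[of s z] loss_nonneg[of t z] by (simp add: abs_le_iff)
next
  case False
  then show ?thesis by (auto simp: separates_def loss_def delta_def)
qed

text \<open>Young's inequality takes the place of Cauchy-Schwarz: after integration it leaves a
  second moment weighted by \<open>lam\<close> and a probability divided by \<open>4 * lam\<close>,
  with \<open>lam\<close> free to be tuned.\<close>

lemma mult_of_bool_le_Young:
  fixes v :: real assumes "0 < lam"
  shows "v * of_bool b \<le> lam * v\<^sup>2 + of_bool b / (4 * lam)"
proof (cases b)
  case True
  have "0 \<le> (2 * lam * v - 1)\<^sup>2 / (4 * lam)" using assms by simp
  also have "\<dots> = lam * v\<^sup>2 + 1 / (4 * lam) - v"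
    using assms by (simp add: power2_eq_square field_simps)
  finally show ?thesis using True by simp
qed (use assms in simp)

context fdr_sample
begin

lemma grid_1_nonneg: "0 \<le> grid q n 1"
  using grid_nonneg[OF q n, of 1] n by simp

lemma measurable_loss [measurable]: "loss t \<in> borel_measurable (borel \<Otimes>\<^sub>M borel)"
  unfolding loss_def delta_def by measurable

lemma measurable_envelope_component:
  "i < n \<Longrightarrow> (\<lambda>\<omega>. envelope U (\<omega> i)) \<in> borel_measurable P"
  by (rule measurable_compose[OF measurable_component]) measurable

lemma measurable_loss_component:
  "i < n \<Longrightarrow> (\<lambda>\<omega>. loss t (\<omega> i)) \<in> borel_measurable P"
  by (rule measurable_compose[OF measurable_component]) measurable

lemma measurable_loss_That:
  assumes "i < n" shows "(\<lambda>\<omega>. loss (ereal (That q n (obs \<omega>))) (\<omega> i)) \<in> borel_measurable P"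
proof -
  note [measurable] = measurable_fst_component[OF assms] measurable_snd_component[OF assms]
  show ?thesis unfolding loss_def delta_def by measurable
qed

lemma measurable_separates:
  assumes "i < n"
  shows "{\<omega> \<in> space P. separates (ereal (That q n (obs \<omega>))) T (snd (\<omega> i))} \<in> sets P"
proof -
  let ?A = "{\<omega> \<in> space P. That q n (obs \<omega>) \<le> snd (\<omega> i)}" and ?B = "{\<omega> \<in> space P. T \<le> ereal (snd (\<omega> i))}"
  have "?A \<in> sets P" "?B \<in> sets P"
    using measurable_snd_component[OF assms]
    by (intro borel_measurable_le measurable_That borel_measurable_const borel_measurable_ereal; assumption)+
  then have "(?A - ?B) \<union> (?B - ?A) \<in> sets P" by blast
  also have "(?A - ?B) \<union> (?B - ?A) = {\<omega> \<in> space P. separates (ereal (That q n (obs \<omega>))) T (snd (\<omega> i))}"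
    by (auto simp: separates_def)
  finally show ?thesis .
qed

lemma integrable_envelope_sq:
  assumes i: "i < n" and K: "(\<integral>\<^sup>+z. ennreal ((envelope U z)\<^sup>2) \<partial>pairlaw F) \<le> ennreal K" "0 \<le> K"
  shows "integrable P (\<lambda>\<omega>. (envelope U (\<omega> i))\<^sup>2)" "(\<integral>\<omega>. (envelope U (\<omega> i))\<^sup>2 \<partial>P) \<le> K"
    "integrable P (\<lambda>\<omega>. envelope U (\<omega> i))"
proof -
  note [measurable] = measurable_envelope_component[OF i]
  have le: "(\<integral>\<^sup>+\<omega>. ennreal ((envelope U (\<omega> i))\<^sup>2) \<partial>P) \<le> ennreal K"
    using K(1) by (subst nn_integral_component[OF i, of "\<lambda>z. ennreal ((envelope U z)\<^sup>2)"]) auto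
  show int: "integrable P (\<lambda>\<omega>. (envelope U (\<omega> i))\<^sup>2)"
    using le by (intro integrableI_bounded) (auto intro: le_less_trans)
  then have "ennreal (\<integral>\<omega>. (envelope U (\<omega> i))\<^sup>2 \<partial>P) \<le> ennreal K"
    using le by (subst nn_integral_eq_integral[symmetric]) auto
  then show "(\<integral>\<omega>. (envelope U (\<omega> i))\<^sup>2 \<partial>P) \<le> K" using K(2) by simp
  have "integrable P (\<lambda>\<omega>. 1 + (envelope U (\<omega> i))\<^sup>2)" using int by simp
  then show "integrable P (\<lambda>\<omega>. envelope U (\<omega> i))"
  proof (rule Bochner_Integration.integrable_bound)
    have "v \<le> 1 + v\<^sup>2" if "0 \<le> v" for v :: real
      using zero_le_power2[of "v - 1"] that by (simp add: power2_eq_square algebra_simps)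
    then show "AE \<omega> in P. norm (envelope U (\<omega> i)) \<le> norm (1 + (envelope U (\<omega> i))\<^sup>2)"
      by (simp add: envelope_nonneg)
  qed measurable
qed

text \<open>Two envelopes are used. While the empirical threshold is at most \<open>16 * T\<close>,
  the envelope at \<open>16 * T\<close> has a bounded second moment and is paired with the
  separation probability \<open>a\<close>. On the rare overshoot, the envelope at
  \<open>grid q n 1\<close> has a moment of logarithmic size and is paired with
  \<open>b\<close>.\<close>

lemma risk_bound:
  assumes lam: "0 < lam" "0 < lam'"
    and a: "\<And>i. i < n \<Longrightarrow> P.prob {\<omega> \<in> space P. separates (ereal (That q n (obs \<omega>))) T (snd (\<omega> i))} \<le> a"
    and b: "P.prob {\<omega> \<in> space P. 16 * T < ereal (That q n (obs \<omega>))} \<le> b"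
  shows "\<bar>Rn q n F - Rtilde q F\<bar> \<le> lam * (2 * log_moment + 16386 / q) + a / (4 * lam)
    + lam' * (2 * log_moment + 512 * grid q n 1) + b / (4 * lam')" (is "_ \<le> ?B")
proof -
  let ?L = "grid q n 1"
  let ?hat = "\<lambda>i \<omega>. loss (ereal (That q n (obs \<omega>))) (\<omega> i)"
  have K1: "0 \<le> 2 * log_moment + 16386 / q" "0 \<le> 2 * log_moment + 512 * ?L"
    using log_moment_nonneg grid_1_nonneg q by auto
  have T16: "T \<le> 16 * T"
    using T_nonneg by (cases T) auto
  have hatL: "ereal (That q n (obs \<omega>)) \<le> ereal ?L" for \<omega>
    using That_le_grid_1[OF q n] by simp
  have [measurable]: "(\<lambda>\<omega>. ereal (That q n (obs \<omega>))) \<in> borel_measurable P" by measurable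
  have main: "integrable P (?hat i)" "integrable P (\<lambda>\<omega>. loss T (\<omega> i))"
    "\<bar>(\<integral>\<omega>. ?hat i \<omega> \<partial>P) - (\<integral>\<omega>. loss T (\<omega> i) \<partial>P)\<bar> \<le> ?B" if i: "i < n" for i
  proof -
    note [measurable] = measurable_envelope_component[OF i] measurable_loss_component[OF i]
      measurable_loss_That[OF i] measurable_snd_component[OF i]
    note E1 = integrable_envelope_sq[OF i envelope_moment_T K1(1)]
    note E2 = integrable_envelope_sq[OF i envelope_moment_linear[OF grid_1_nonneg] K1(2)]
    let ?A = "{\<omega> \<in> space P. separates (ereal (That q n (obs \<omega>))) T (snd (\<omega> i))}"
    let ?C = "{\<omega> \<in> space P. 16 * T < ereal (That q n (obs \<omega>))}"
    have mA [measurable]: "?A \<in> sets P" by (rule measurable_separates[OF i])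
    have mC [measurable]: "?C \<in> sets P" by measurable
    show i1: "integrable P (?hat i)"
      by (rule Bochner_Integration.integrable_bound[OF E2(3)])
        (measurable, intro AE_I2, simp only: real_norm_def abs_of_nonneg loss_nonneg envelope_nonneg loss_le_envelope hatL)
    show i2: "integrable P (\<lambda>\<omega>. loss T (\<omega> i))"
      by (rule Bochner_Integration.integrable_bound[OF E1(3)])
        (measurable, intro AE_I2, simp only: real_norm_def abs_of_nonneg loss_nonneg envelope_nonneg loss_le_envelope T16)
    let ?g = "\<lambda>\<omega>. lam * (envelope (16 * T) (\<omega> i))\<^sup>2 + indicator ?A \<omega> / (4 * lam)
       + lam' * (envelope (ereal ?L) (\<omega> i))\<^sup>2 + indicator ?C \<omega> / (4 * lam')"
    have "\<bar>?hat i \<omega> - loss T (\<omega> i)\<bar> \<le> ?g \<omega>" if \<omega>: "\<omega> \<in> space P" for \<omega>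
    proof (cases "16 * T < ereal (That q n (obs \<omega>))")
      case False
      have "\<bar>?hat i \<omega> - loss T (\<omega> i)\<bar> \<le>
          envelope (16 * T) (\<omega> i) * of_bool (separates (ereal (That q n (obs \<omega>))) T (snd (\<omega> i)))"
        using False T16 by (intro loss_diff_le) auto
      also have "\<dots> \<le> lam * (envelope (16 * T) (\<omega> i))\<^sup>2 + indicator ?A \<omega> / (4 * lam)"
        using mult_of_bool_le_Young[OF lam(1)] \<omega> by (simp add: indicator_def)
      also have "\<dots> \<le> ?g \<omega>"
        using lam by simp
      finally show ?thesis .
    next
      case True
      \<comment> \<open>On the overshoot event the population threshold is below the cap as well, so
        the second envelope dominates both losses.\<close>
      then have "T \<le> ereal ?L" using T16 hatL[of \<omega>] by (meson less_imp_le order_trans)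
      then have "\<bar>?hat i \<omega> - loss T (\<omega> i)\<bar> \<le>
          envelope (ereal ?L) (\<omega> i) * of_bool (separates (ereal (That q n (obs \<omega>))) T (snd (\<omega> i)))"
        using hatL by (intro loss_diff_le)
      also have "\<dots> \<le> envelope (ereal ?L) (\<omega> i) * of_bool True"
        by (intro mult_left_mono envelope_nonneg) auto
      also have "\<dots> \<le> lam' * (envelope (ereal ?L) (\<omega> i))\<^sup>2 + of_bool True / (4 * lam')"
        by (rule mult_of_bool_le_Young[OF lam(2)])
      also have "\<dots> \<le> ?g \<omega>"
        using lam True \<omega> by simp
      finally show ?thesis .
    qed
    note ptw = this
    have A: "integrable P (\<lambda>\<omega>. indicator ?A \<omega> :: real)" "integrable P (\<lambda>\<omega>. indicator ?C \<omega> :: real)"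
      using P.emeasure_finite by (simp_all add: less_top[symmetric])
    have ig: "integrable P ?g"
      using E1(1) E2(1) A by (intro Bochner_Integration.integrable_add integrable_mult_right integrable_divide) auto
    have "\<bar>(\<integral>\<omega>. ?hat i \<omega> \<partial>P) - (\<integral>\<omega>. loss T (\<omega> i) \<partial>P)\<bar> = \<bar>\<integral>\<omega>. ?hat i \<omega> - loss T (\<omega> i) \<partial>P\<bar>"
      using i1 i2 by simp
    also have "\<dots> \<le> (\<integral>\<omega>. \<bar>?hat i \<omega> - loss T (\<omega> i)\<bar> \<partial>P)"
      by (rule integral_abs_bound)
    also have "\<dots> \<le> (\<integral>\<omega>. ?g \<omega> \<partial>P)"
      using i1 i2 ig ptw by (intro integral_mono) auto
    also have "\<dots> = lam * (\<integral>\<omega>. (envelope (16 * T) (\<omega> i))\<^sup>2 \<partial>P) + P.prob ?A / (4 * lam)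
       + lam' * (\<integral>\<omega>. (envelope (ereal ?L) (\<omega> i))\<^sup>2 \<partial>P) + P.prob ?C / (4 * lam')"
      using E1(1) E2(1) A sets.sets_into_space[OF mA] sets.sets_into_space[OF mC]
      by (simp add: Int_absorb2)
    also have "\<dots> \<le> ?B"
      using lam E1(2) E2(2) a[OF i] b by (intro add_mono mult_left_mono divide_right_mono) auto
    finally show "\<bar>(\<integral>\<omega>. ?hat i \<omega> \<partial>P) - (\<integral>\<omega>. loss T (\<omega> i) \<partial>P)\<bar> \<le> ?B" .
  qed
  have R1: "Rn q n F = (1 / real n) * (\<Sum>i<n. \<integral>\<omega>. ?hat i \<omega> \<partial>P)"
    unfolding Rn_def loss_def[symmetric] using main(1)
    by (subst integral_mult_right_zero, subst Bochner_Integration.integral_sum) auto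
  have "Rtilde q F = (\<integral>z. loss T z \<partial>pairlaw F)"
    unfolding Rtilde_def loss_def by (simp add: split_def)
  then have R2: "Rtilde q F = (\<integral>\<omega>. loss T (\<omega> i) \<partial>P)" if "i < n" for i
    using integral_component[OF that measurable_loss[of T]] by simp
  have "Rn q n F - Rtilde q F = (1 / real n) * (\<Sum>i<n. (\<integral>\<omega>. ?hat i \<omega> \<partial>P) - Rtilde q F)"
    unfolding R1 using n by (simp add: sum_subtractf field_simps)
  also have "\<bar>\<dots>\<bar> \<le> (1 / real n) * (\<Sum>i<n. \<bar>(\<integral>\<omega>. ?hat i \<omega> \<partial>P) - Rtilde q F\<bar>)"
    by (simp add: abs_mult divide_right_mono)
  also have "\<dots> \<le> (1 / real n) * (\<Sum>i<n. ?B)"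
    using main(3) R2 by (intro mult_left_mono sum_mono) auto
  also have "\<dots> = ?B" using n by simp
  finally show ?thesis .
qed

lemma prob_That_overshoot:
  assumes nq: "1 \<le> q * real n"
  shows "P.prob {\<omega> \<in> space P. 16 * T < ereal (That q n (obs \<omega>))} \<le> exp (- 2 * (1 / q - 1)\<^sup>2 * sqrt (real n))"
proof (cases "\<exists>t. T = ereal t \<and> t \<le> ln (real n) / 8")
  case True
  then obtain t where t: "T = ereal t" "t \<le> ln (real n) / 8" by blast
  have t0: "0 < t" and tT: "tilt F t = 1 / q" using T_pos[OF t(1)] tilt_T[OF t(1)] by auto
  have k: "0 < 1 / q - 1" using q by simp
  \<comment> \<open>Comparing the chords to \<open>t\<close> and \<open>2 * t\<close>: between these
    points the tilt rises by at least \<open>1 / q - 1\<close>.\<close>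
  have "(tilt F t - 1) * (2 * t) \<le> (tilt F (2 * t) - 1) * t"
    using t0 by (intro tilt_slope_mono) auto
  then have "(2 * (tilt F t - 1)) * t \<le> (tilt F (2 * t) - 1) * t" by (simp add: mult_ac)
  then have slope: "1 / q - 1 \<le> tilt F (2 * t) - 1 / q"
    using t0 tT by (simp add: mult_le_cancel_right)
  \<comment> \<open>Since \<open>t \<le> ln n / 8\<close>, the squared factor
    \<open>exp (- 4 * t)\<close> in the Hoeffding exponent is at least the inverse root of
    \<open>n\<close>, which leaves an exponent of order \<open>sqrt n\<close>.\<close>
  have "1 / sqrt (real n) = exp (- ln (real n) / 2)"
    using n by (simp add: exp_minus ln_sqrt[symmetric] field_simps)
  also have "\<dots> \<le> exp (- (4 * t))" using t by simp
  also have "\<dots> = (exp (- (2 * t)))\<^sup>2" by (simp add: exp_double[symmetric])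
  finally have e: "1 / sqrt (real n) \<le> (exp (- (2 * t)))\<^sup>2" .
  have "P.prob {\<omega> \<in> space P. 16 * T < ereal (That q n (obs \<omega>))} \<le> P.prob {\<omega> \<in> space P. 2 * t < That q n (obs \<omega>)}"
    using t t0 by (intro P.finite_measure_mono) auto
  also have "\<dots> \<le> exp (- 2 * real n * (exp (- (2 * t)) * (tilt F (2 * t) - 1 / q))\<^sup>2)"
    using t0 slope k by (intro prob_That_greater) auto
  also have "\<dots> \<le> exp (- 2 * (1 / q - 1)\<^sup>2 * sqrt (real n))"
  proof -
    have "(1 / q - 1)\<^sup>2 * sqrt (real n) = real n * (1 / sqrt (real n) * (1 / q - 1)\<^sup>2)"
      using n by (simp add: real_div_sqrt field_simps)
    also have "\<dots> \<le> real n * ((exp (- (2 * t)))\<^sup>2 * (tilt F (2 * t) - 1 / q)\<^sup>2)"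
      using e slope k by (intro mult_left_mono mult_mono power_mono) auto
    finally show ?thesis by (simp add: power_mult_distrib mult.assoc)
  qed
  finally show ?thesis .
next
  case False
  have "ereal (That q n (obs \<omega>)) \<le> 16 * T" for \<omega>
  proof (cases T)
    case (real t)
    then have t: "ln (real n) / 8 < t" using False by auto
    have "That q n (obs \<omega>) \<le> ln (real n / q)"
      using That_le_grid_1[OF q n, of "obs \<omega>"] by (simp add: grid_def)
    also have "\<dots> = ln (real n) + ln (1 / q)" using n q by (simp add: ln_div)
    \<comment> \<open>The empirical threshold is now at most \<open>2 * ln n\<close>, which is less
      than \<open>16 * t\<close>; the event is empty.\<close>
    also have "ln (1 / q) \<le> ln (real n)"
      using nq q n by (intro ln_mono) (auto simp: field_simps)
    finally show ?thesis using t real by simp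
  qed (use T_nonneg in auto)
  then have *: "{\<omega> \<in> space P. 16 * T < ereal (That q n (obs \<omega>))} = {}"
    by (auto dest: leD)
  show ?thesis unfolding * by simp
qed

text \<open>For \<open>T \<le> tau\<close>, separation requires an observation within
  \<open>e\<close> of \<open>T\<close> or an empirical threshold more than \<open>e\<close> away
  from it. For larger \<open>T\<close> both thresholds exceed \<open>tau / 2\<close> with high
  probability, so the observation must be at least \<open>tau / 2\<close>. The number
  \<open>g\<close> bounds every Hoeffding deviation from below, independently of
  \<open>F\<close>.\<close>

lemma prob_separates:
  assumes i: "i < n" and e: "0 < e" "e \<le> tau / 2" and tau: "tau \<le> grid q n 1"
  defines "g \<equiv> exp (- (tau + e)) * ((1 / q - 1) * e / tau)"
  shows "P.prob {\<omega> \<in> space P. separates (ereal (That q n (obs \<omega>))) T (snd (\<omega> i))}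
    \<le> 2 * e + exp (- tau / 2) / q + 2 * real n * exp (- 2 * real n * g\<^sup>2)"
proof -
  note [measurable] = measurable_snd_component[OF i]
  let ?A = "{\<omega> \<in> space P. separates (ereal (That q n (obs \<omega>))) T (snd (\<omega> i))}"
  let ?x = "exp (- 2 * real n * g\<^sup>2)"
  have k: "0 < 1 / q - 1" using q by simp
  have g0: "0 \<le> g" using k e by (simp add: g_def)
  have mono: "exp (- 2 * real n * G\<^sup>2) \<le> ?x" if "g \<le> G" for G
    using power_mono[OF that g0, of 2] by (simp add: mult_left_mono)
  show ?thesis
  proof (cases "T \<le> ereal tau")
    case True
    then obtain t where t: "T = ereal t" "t \<le> tau" using T_nonneg by (cases T) auto
    have t0: "0 < t" and tT: "tilt F t = 1 / q" using T_pos[OF t(1)] tilt_T[OF t(1)] by auto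
    have gap: "(1 / q - 1) * e / tau \<le> (1 / q - 1) * e / t"
      using t t0 k e by (intro divide_left_mono) auto
    have lower: "(1 / q - 1) * e / tau \<le> 1 / q - tilt F (t - e)"
    \<comment> \<open>To the right of 0 the chord slope gives the gap. Otherwise
      \<open>tilt F (t - e) \<le> 1\<close>, and the gap is at least the full
      \<open>1 / q - 1\<close>.\<close>
    proof (cases "0 < t - e")
      case True
      have "(tilt F (t - e) - 1) * t \<le> (1 / q - 1) * (t - e)"
        using tilt_slope_mono[of "t - e" t] True e tT by simp
      then have "(1 / q - 1) * e \<le> (1 / q - tilt F (t - e)) * t"
        by (simp add: algebra_simps diff_divide_distrib)
      then have "(1 / q - 1) * e / t \<le> 1 / q - tilt F (t - e)"
        using t0 by (simp only: pos_divide_le_eq)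
      with gap show ?thesis by linarith
    next
      case False
      then have "tilt F (t - e) \<le> 1" using tilt_mono[of "t - e" 0] tilt_0 by simp
      moreover have "(1 / q - 1) * (e / tau) \<le> (1 / q - 1) * 1"
        using k e by (intro mult_left_mono) auto
      ultimately show ?thesis by simp
    qed
    have "(1 / q - 1) * (t + e) \<le> (tilt F (t + e) - 1) * t"
      using tilt_slope_mono[of t "t + e"] t0 e tT by simp
    then have "(1 / q - 1) * e \<le> (tilt F (t + e) - 1 / q) * t"
      by (simp add: algebra_simps add_divide_distrib)
    then have "(1 / q - 1) * e / t \<le> tilt F (t + e) - 1 / q"
      using t0 by (simp only: pos_divide_le_eq)
    with gap have upper: "(1 / q - 1) * e / tau \<le> tilt F (t + e) - 1 / q" by linarith
    have pos: "0 < (1 / q - 1) * e / tau" using k e by simp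
    let ?W = "{\<omega> \<in> space P. \<bar>snd (\<omega> i) - t\<bar> \<le> e}"
    let ?Lo = "{\<omega> \<in> space P. That q n (obs \<omega>) < t - e}"
    let ?Up = "{\<omega> \<in> space P. t + e < That q n (obs \<omega>)}"
    have "?A \<subseteq> ?W \<union> (?Lo \<union> ?Up)"
      unfolding t(1) separates_def by (auto simp: abs_le_iff)
    then have "P.prob ?A \<le> P.prob (?W \<union> (?Lo \<union> ?Up))"
      by (intro P.finite_measure_mono) auto
    also have "\<dots> \<le> P.prob ?W + P.prob (?Lo \<union> ?Up)"
      by (intro measure_Un_le) auto
    also have "P.prob (?Lo \<union> ?Up) \<le> P.prob ?Lo + P.prob ?Up"
      by (intro measure_Un_le) auto
    also have "P.prob ?W \<le> 2 * e"
    proof -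
      have "{z \<in> space (pairlaw F). \<bar>snd z - t\<bar> \<le> e} \<in> sets (pairlaw F)" by measurable
      then have "{z :: real \<times> real. \<bar>snd z - t\<bar> \<le> e} \<in> sets (borel \<Otimes>\<^sub>M borel)" by (simp add: sets_pairlaw)
      from prob_component[OF i this] show ?thesis using pairlaw_window[of e t] e by simp
    qed
    also have "P.prob ?Lo \<le> real n * ?x"
    proof -
      have "P.prob ?Lo \<le> real n * exp (- 2 * real n * (exp (- (t - e)) * (1 / q - tilt F (t - e)))\<^sup>2)"
        using t e tau lower pos by (intro prob_That_less) auto
      also have "\<dots> \<le> real n * ?x"
        unfolding g_def using lower pos t e
        by (intro mult_left_mono mono[unfolded g_def] mult_mono) auto
      finally show ?thesis .
    qed
    also have "P.prob ?Up \<le> real n * ?x"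
    proof -
      have "P.prob ?Up \<le> exp (- 2 * real n * (exp (- (t + e)) * (tilt F (t + e) - 1 / q))\<^sup>2)"
        using t0 e upper pos by (intro prob_That_greater) auto
      also have "\<dots> \<le> 1 * ?x"
        unfolding g_def mult_1 using upper pos t e
        by (intro mono[unfolded g_def] mult_mono) auto
      also have "\<dots> \<le> real n * ?x"
        using n by (intro mult_right_mono) auto
      finally show ?thesis .
    qed
    also have "2 * e + (real n * ?x + real n * ?x) \<le> 2 * e + exp (- tau / 2) / q + 2 * real n * ?x"
      using q by simp
    finally show ?thesis by simp
  next
    case False
    let ?s = "tau / 2"
    have tauT: "ereal tau < T" using False by simp
    have s0: "0 < ?s" using e by simp
    \<comment> \<open>At half of \<open>tau\<close> the tilt has risen by at most half of
      \<open>1 / q - 1\<close>; the other half is the gap, and \<open>e \<le> tau / 2\<close> makes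
      it large enough.\<close>
    have "(tilt F ?s - 1) * tau \<le> (tilt F tau - 1) * ?s"
      using s0 by (intro tilt_slope_mono) auto
    also have "\<dots> \<le> (1 / q - 1) * ?s"
      using tilt_below_T[OF tauT] s0 by (intro mult_right_mono) auto
    finally have "(tilt F ?s - 1) * tau \<le> ((1 / q - 1) / 2) * tau" by simp
    then have lower: "(1 / q - 1) / 2 \<le> 1 / q - tilt F ?s"
      using s0 by (simp add: mult_le_cancel_right)
    have "(1 / q - 1) * (e / tau) \<le> (1 / q - 1) * (1 / 2)"
      using k e by (intro mult_left_mono) (auto simp: field_simps)
    then have "(1 / q - 1) * e / tau \<le> (1 / q - 1) / 2" by simp
    from order_trans[OF this lower] have lower': "(1 / q - 1) * e / tau \<le> 1 / q - tilt F ?s" .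
    have pos: "0 < (1 / q - 1) * e / tau" using k e by simp
    let ?W = "{\<omega> \<in> space P. ?s \<le> snd (\<omega> i)}"
    let ?Lo = "{\<omega> \<in> space P. That q n (obs \<omega>) < ?s}"
    have sT: "ereal ?s \<le> T"
      using tauT s0 by (intro order_trans[OF _ less_imp_le[OF tauT]]) simp
    have "?A \<subseteq> ?W \<union> ?Lo"
    proof (intro subsetI)
      fix \<omega> assume w: "\<omega> \<in> ?A"
      show "\<omega> \<in> ?W \<union> ?Lo"
      proof (cases "T \<le> ereal (snd (\<omega> i))")
        case True
        with sT have "ereal ?s \<le> ereal (snd (\<omega> i))" by (rule order_trans)
        with w show ?thesis by simp
      next
        case False
        with w show ?thesis by (auto simp: separates_def)
      qed
    qed
    then have "P.prob ?A \<le> P.prob (?W \<union> ?Lo)"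
      by (intro P.finite_measure_mono) auto
    also have "\<dots> \<le> P.prob ?W + P.prob ?Lo"
      by (intro measure_Un_le) auto
    also have "P.prob ?W \<le> exp (- tau / 2) / q"
    proof -
      have "{z \<in> space (pairlaw F). ?s \<le> snd z} \<in> sets (pairlaw F)" by measurable
      then have "{z :: real \<times> real. ?s \<le> snd z} \<in> sets (borel \<Otimes>\<^sub>M borel)" by (simp add: sets_pairlaw)
      from prob_component[OF i this] have "P.prob ?W = exp (- ?s) * tilt F ?s"
        using pairlaw_tail[of ?s] s0 by simp
      also have "\<dots> \<le> exp (- ?s) * (1 / q)"
        using lower' pos by (intro mult_left_mono) auto
      finally show ?thesis by simp
    qed
    also have "P.prob ?Lo \<le> real n * ?x"
    proof -
      have "P.prob ?Lo \<le> real n * exp (- 2 * real n * (exp (- ?s) * (1 / q - tilt F ?s))\<^sup>2)"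
        using s0 tau lower' pos by (intro prob_That_less) auto
      also have "\<dots> \<le> real n * ?x"
        unfolding g_def using lower' pos s0 e
        by (intro mult_left_mono mono[unfolded g_def] mult_mono) auto
      finally show ?thesis .
    qed
    also have "exp (- tau / 2) / q + real n * ?x \<le> 2 * e + exp (- tau / 2) / q + 2 * real n * ?x"
      using e by simp
    finally show ?thesis by simp
  qed
qed

end

section \<open>Uniformity over the mixing distributions and the limit\<close>

lemma mixing_of_FF: "F \<in> FF \<Longrightarrow> mixing F"
proof -
  assume F: "F \<in> FF"
  then interpret prob_space F by (simp add: FF_def)
  have s: "sets F = sets borel" "emeasure F {..<1} = 0" using F by (auto simp: FF_def)
  have "AE \<mu> in F. 1 \<le> \<mu>"
    by (rule AE_I[of _ _ "{..<1}"]) (use s in \<open>auto simp: sets_eq_imp_space_eq\<close>)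
  with s show ?thesis by unfold_locales
qed

text \<open>The parameters are fixed in turn, none depending on \<open>F\<close>: \<open>lam\<close>
  makes the bounded moment contribute \<open>\<epsilon> / 4\<close>, then \<open>tau\<close> and
  \<open>e\<close> do the same for the part of the separation probability free of \<open>n\<close>,
  and finally \<open>n\<close> is taken large.\<close>

lemma uniform_risk_convergence:
  assumes q: "0 < q" "q < 1" and \<epsilon>: "0 < \<epsilon>"
  shows "\<forall>\<^sub>F n in sequentially. \<forall>F\<in>FF. \<bar>Rn q n F - Rtilde q F\<bar> \<le> \<epsilon>"
proof -
  define K where "K = 2 * log_moment + 16386 / q"
  have K: "0 < K" using log_moment_nonneg q by (simp add: K_def add_nonneg_pos)
  define lam where "lam = \<epsilon> / (4 * K)"
  have lam: "0 < lam" "lam * K = \<epsilon> / 4" using K \<epsilon> by (simp_all add: lam_def)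
  have "((\<lambda>tau. exp (- tau / 2) / q) \<longlongrightarrow> 0) at_top" using q by real_asymp
  then have "\<forall>\<^sub>F tau in at_top. exp (- tau / 2) / q < \<epsilon> * lam / 2 \<and> 0 < tau"
    using \<epsilon> lam by (intro eventually_conj order_tendstoD(2) eventually_gt_at_top) auto
  then obtain tau where tau: "exp (- tau / 2) / q < \<epsilon> * lam / 2" "0 < tau"
    using eventually_happens'[OF trivial_limit_at_top_linorder] by blast
  define e where "e = min (tau / 2) (\<epsilon> * lam / 4)"
  have e: "0 < e" "e \<le> tau / 2" "2 * e \<le> \<epsilon> * lam / 2"
    using tau \<epsilon> lam by (auto simp: e_def)
  define g where "g = exp (- (tau + e)) * ((1 / q - 1) * e / tau)"
  have g: "0 < g" using e tau q by (simp add: g_def)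
  define k where "k = 2 * (1 / q - 1)\<^sup>2"
  have k: "0 < k" using q by (simp add: k_def)
  \<comment> \<open>The terms depending on \<open>n\<close>. The second Young parameter is
    \<open>n powr (- 1 / 8)\<close>: it beats the logarithmic moment, and its reciprocal is beaten
    by \<open>exp (- k * sqrt n)\<close>.\<close>
  define r where "r n = 2 * real n * exp (- 2 * real n * g\<^sup>2) / (4 * lam)
     + real n powr (- 1 / 8) * (2 * log_moment + 512 * ln (real n / q))
     + exp (- k * sqrt (real n)) / (4 * real n powr (- 1 / 8))" for n
  have g2: "0 < g\<^sup>2" using g by simp
  have lim: "(\<lambda>n. 2 * real n * exp (- 2 * real n * c) / (4 * lam)) \<longlonglongrightarrow> 0" if "0 < c" for c
    using that lam(1) by real_asymp
  have "(\<lambda>n. real n powr (- 1 / 8) * (2 * c + 512 * ln (real n / q))) \<longlonglongrightarrow> 0" for c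
    using q(1) by real_asymp
  moreover have "(\<lambda>n. exp (- k * sqrt (real n)) / (4 * real n powr (- 1 / 8))) \<longlonglongrightarrow> 0"
    using k by real_asymp
  ultimately have "r \<longlonglongrightarrow> 0 + 0 + 0"
    unfolding r_def by (intro tendsto_add lim[OF g2])
  then have "r \<longlonglongrightarrow> 0" by simp
  then have ev1: "\<forall>\<^sub>F n in sequentially. r n < \<epsilon> / 4"
    using \<epsilon> by (intro order_tendstoD(2)) auto
  have ev2: "\<forall>\<^sub>F n in sequentially. 1 \<le> q * real n" using q(1) by real_asymp
  have ev3: "\<forall>\<^sub>F n in sequentially. tau \<le> ln (real n / q)" using q(1) by real_asymp
  show ?thesis
    using ev1 ev2 ev3 eventually_gt_at_top[of 0]
  proof eventually_elim
    case (elim n)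
    show ?case
    proof
      fix F assume "F \<in> FF"
      then interpret mixing F by (rule mixing_of_FF)
      interpret fdr_sample F q n by unfold_locales (use q elim in auto)
      have grid: "grid q n 1 = ln (real n / q)" by (simp add: grid_def)
      let ?a = "2 * e + exp (- tau / 2) / q + 2 * real n * exp (- 2 * real n * g\<^sup>2)"
      have "\<bar>Rn q n F - Rtilde q F\<bar> \<le> lam * (2 * log_moment + 16386 / q) + ?a / (4 * lam)
        + real n powr (- 1 / 8) * (2 * log_moment + 512 * grid q n 1)
        + exp (- 2 * (1 / q - 1)\<^sup>2 * sqrt (real n)) / (4 * real n powr (- 1 / 8))"
      proof (rule risk_bound)
        show "P.prob {\<omega> \<in> space P. separates (ereal (That q n (obs \<omega>))) T (snd (\<omega> i))} \<le> ?a" if "i < n" for i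
          unfolding g_def using that e elim grid by (intro prob_separates) auto
        show "P.prob {\<omega> \<in> space P. 16 * T < ereal (That q n (obs \<omega>))} \<le> exp (- 2 * (1 / q - 1)\<^sup>2 * sqrt (real n))"
          using elim by (intro prob_That_overshoot)
      qed (use lam elim in auto)
      also have "\<dots> = \<epsilon> / 4 + (2 * e + exp (- tau / 2) / q) / (4 * lam) + r n"
        unfolding r_def grid k_def K_def[symmetric] lam(2) by (simp add: add_divide_distrib)
      also have "\<dots> \<le> \<epsilon> / 4 + \<epsilon> / 4 + \<epsilon> / 4"
      proof (intro add_mono order_refl)
        show "(2 * e + exp (- tau / 2) / q) / (4 * lam) \<le> \<epsilon> / 4"
        proof -
          have "2 * e + exp (- tau / 2) / q \<le> \<epsilon> * lam" using tau(1) e(3) by linarith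
          then have "(2 * e + exp (- tau / 2) / q) / (4 * lam) \<le> (\<epsilon> * lam) / (4 * lam)"
            by (rule divide_right_mono) (use lam in simp)
          then show ?thesis using lam by simp
        qed
      qed (use elim in simp)
      also have "\<dots> \<le> \<epsilon>" using \<epsilon> by simp
      finally show "\<bar>Rn q n F - Rtilde q F\<bar> \<le> \<epsilon>" .
    qed
  qed
qed

text \<open>The supremum is taken in the extended reals, where the empty one is minus infinity; a
  member of \<open>S\<close> supplies the lower bound 0.\<close>

lemma SUP_risk_tendsto_0:
  assumes q: "0 < q" "q < 1" and S: "S \<subseteq> FF" "S \<noteq> {}"
  shows "(\<lambda>n. SUP F\<in>S. ereal \<bar>Rn q n F - Rtilde q F\<bar>) \<longlonglongrightarrow> 0"
proof (rule order_tendstoI)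
  fix a :: ereal assume "a < 0"
  obtain F where F: "F \<in> S" using S by blast
  have "0 \<le> (SUP F\<in>S. ereal \<bar>Rn q n F - Rtilde q F\<bar>)" for n
    by (rule SUP_upper2[OF F]) simp
  with \<open>a < 0\<close> show "\<forall>\<^sub>F n in sequentially. a < (SUP F\<in>S. ereal \<bar>Rn q n F - Rtilde q F\<bar>)"
    by (auto intro!: always_eventually intro: less_le_trans)
next
  fix a :: ereal assume "0 < a"
  then obtain \<epsilon> where \<epsilon>: "0 < \<epsilon>" "ereal \<epsilon> < a"
    using ereal_dense2[of 0 a] by auto
  show "\<forall>\<^sub>F n in sequentially. (SUP F\<in>S. ereal \<bar>Rn q n F - Rtilde q F\<bar>) < a"
    using uniform_risk_convergence[OF q \<epsilon>(1)]
  proof eventually_elim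
    case (elim n)
    then have "(SUP F\<in>S. ereal \<bar>Rn q n F - Rtilde q F\<bar>) \<le> ereal \<epsilon>"
      using S by (intro SUP_least) auto
    then show ?case using \<epsilon>(2) by (rule le_less_trans)
  qed
qed

text \<open>At the point mass at 1 the logarithm vanishes, so every moment constraint holds.\<close>

lemma return_1_in_FFp: "return borel 1 \<in> FFp p \<eta>"
  by (auto simp: FFp_def FF_def prob_space_return nn_integral_return)

theorem theorem6p1:
  fixes q :: real
  assumes "0 < q" "q < 1"
  shows "(\<lambda>n. SUP F\<in>FF. ereal \<bar>Rn q n F - Rtilde q F\<bar>) \<longlonglongrightarrow> 0
     \<and> (\<forall>p \<eta>. 0 < p \<and> p < 2 \<and> 0 < \<eta> \<longrightarrow>
          (\<lambda>n. SUP F\<in>FFp p \<eta>. ereal \<bar>Rn q n F - Rtilde q F\<bar>) \<longlonglongrightarrow> 0)"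
proof (intro conjI allI impI)
  have ne: "FFp p \<eta> \<noteq> {}" for p \<eta> using return_1_in_FFp by blast
  have sub: "FFp p \<eta> \<subseteq> FF" for p \<eta> by (simp add: FFp_def)
  from ne[of 1 1] sub[of 1 1] have "FF \<noteq> {}" by blast
  then show "(\<lambda>n. SUP F\<in>FF. ereal \<bar>Rn q n F - Rtilde q F\<bar>) \<longlonglongrightarrow> 0"
    by (rule SUP_risk_tendsto_0[OF assms order_refl])
  show "(\<lambda>n. SUP F\<in>FFp p \<eta>. ereal \<bar>Rn q n F - Rtilde q F\<bar>) \<longlonglongrightarrow> 0" for p \<eta>
    by (rule SUP_risk_tendsto_0[OF assms sub ne])
qed

end
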